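(* Assume the framework described in the context. Let $\mathcal A,\mathcal B\in\mathcal K$ and $\varepsilon\in D$, $\varepsilon\geq0$. If player II has a winning strategy in $\mathrm{EFD}^{\alpha,\varepsilon}(\mathcal A,\mathcal B)$ for every ordinal $\alpha<(\mathrm{dens}(\mathcal A)+\mathrm{dens}(\mathcal B))^+$, then II has a winning strategy in $\mathrm{EF}^{\omega,\varepsilon}(\mathcal A,\mathcal B)$.
   Context: $\mathrm{dens}(\mathcal A)$ is the density character (least cardinality of a dense subset) of $\mathcal A$ in its metric, and $\kappa^+$ is the cardinal successor. Fix a vocabulary $L$ and a class $\mathcal K$ of $L$-structures; $\Phi$ is the set of atomic $L$-formulas (no equality). $L$ has approximations for $\mathcal K$: there are a dense set $D\subseteq[0,\infty)$ with $0\in D$, closed under addition, and maps $\mathrm{Appr}\colon\Phi\times D\to\Phi$, $\mathrm{neg}\colon\Phi\to\Phi$ such that (for all $\varphi\in\Phi$, $\mathcal A\in\mathcal K$, tuples $\bar a$, $\varepsilon,\delta\in D$): $\mathrm{Appr}(\varphi,\varepsilon)$, $\mathrm{neg}(\varphi)$ have the same variables as $\varphi$; $\mathrm{Appr}(\varphi,0)\equiv\varphi$; $\mathrm{Appr}(\mathrm{Appr}(\varphi,\varepsilon),\delta)\equiv\mathrm{Appr}(\varphi,\varepsilon+\delta)$; $\varphi\models\mathrm{Appr}(\varphi,\varepsilon)$; $\mathcal A\models\varphi(\bar a)$ iff $\mathcal A\models\mathrm{Appr}(\varphi,\varepsilon)(\bar a)$ for all $\varepsilon\in D\setminus\{0\}$;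 $\mathrm{neg}(\mathrm{neg}\varphi)=\varphi$; $\mathcal A\not\models\varphi(\bar a)$ iff $\mathcal A\models\mathrm{neg}(\mathrm{Appr}(\varphi,\varepsilon))(\bar a)$ for some $\varepsilon\in D\setminus\{0\}$; for $\varepsilon\geq\delta>0$, $\mathrm{Appr}(\mathrm{neg}(\mathrm{Appr}(\varphi,\varepsilon)),\delta)\equiv\mathrm{neg}(\mathrm{Appr}(\varphi,\varepsilon-\delta))$. Each $\mathcal A\in\mathcal K$ carries a complete metric such that each relation $d(a,a')\leq r$, $r\in D$, is defined by an atomic formula; topological notions refer to it; for tuples $d(\bar a,\bar b)<\delta$ is coordinatewise. All real parameters range over $D$. $\mathcal I=(\mathcal I_\varepsilon)_{\varepsilon\geq0}$ is an isomorphism notion: classes of bijections between members of $\mathcal K$ containing all $L$-isomorphisms in $\mathcal I_0$, closed under inverses, with $g\circ f\in\mathcal I_{\varepsilon+\varepsilon'}$ for $f\in\mathcal I_\varepsilon$, $g\in\mathcal I_{\varepsilon'}$ composable, increasing in $\varepsilon$, and such that a surjection $f\colon\mathcal A\to\mathcal B$ is in $\mathcal I_\varepsilon$ iff $\mathcal A\models\varphi(\bar a)\Rightarrow\mathcal B\models\mathrm{Appr}(\varphi,\varepsilon)(f(\bar a))$ for all atomic $\varphi$ and $\bar a$. $L$ is good for $(\mathcal K,\mathcal I)$: there are $\mathrm{Good}(k)\subseteq\Phi$ ($k<\omega$) such that every atomic formula is equivalent to a member of some $\mathrm{Good}(k)$; $\mathrm{Good}(k)\subseteq\mathrm{Good}(k+1)$;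 $\varphi\in\mathrm{Good}(k)$ implies $\mathrm{Appr}(\varphi,\varepsilon),\mathrm{neg}(\mathrm{Appr}(\varphi,\varepsilon))\in\mathrm{Good}(\lceil ke^\varepsilon\rceil)$; for each $\mathcal A$, $k$, $\varepsilon>0$ there is $\delta>0$ such that $\varphi(\bar v)\in\mathrm{Good}(k)$, $d(\bar a,\bar b)<\delta$, $\mathcal A\models\varphi(\bar a)$ imply $\mathcal A\models\mathrm{Appr}(\varphi,\varepsilon)(\bar b)$; and whenever $(a_n)$ in $\mathcal A$, $(b_n)$ in $\mathcal B$, $(\varepsilon_n)$ in $(\varepsilon,\infty)$ decreasing to $\varepsilon$ satisfy $\mathcal A\models\varphi(a_{i_0},\dots)\Rightarrow\mathcal B\models\mathrm{Appr}(\varphi,\varepsilon_k)(b_{i_0},\dots)$ for all $k$, $\varphi\in\mathrm{Good}(k)$, indices $\geq k$, then for each increasing $(i_n)$, $(a_{i_n})$ is Cauchy iff $(b_{i_n})$ is. Games (structures treated as disjoint): in $\mathrm{EF}^{\omega,\varepsilon}(\mathcal A,\mathcal B)$, in each round $k<\omega$ I picks $x_k\in\mathcal A\cup\mathcal B$ and $\varepsilon_k>\varepsilon$, II answers $y_k$ in the other structure; $a_k,b_k$ are the members of $\{x_k,y_k\}$ in $\mathcal A$, $\mathcal B$; II wins iff for all $k$, $\varphi(v_0,\dots,v_{m-1})\in\mathrm{Good}(k)$, $i_0,\dots,i_{m-1}\geq k$: $\mathcal A\models\varphi(a_{i_0},\dots,a_{i_{m-1}})\Rightarrow\mathcal B\models\mathrm{Appr}(\varphi,\varepsilon_k)(b_{i_0},\dots,b_{i_{m-1}})$.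 In the dynamic game $\mathrm{EFD}^{\alpha,\varepsilon}(\mathcal A,\mathcal B)$, in round $i$ I picks $x_i\in\mathcal A\cup\mathcal B$, $\varepsilon_i>\varepsilon$, $k_i<\omega$ and an ordinal $\alpha_i<\alpha$ with $\alpha_i<\alpha_j$ for $j<i$; II answers as before; the play ends after the round in which $\alpha_i=0$. II wins iff for every round $i$, every $\varphi(v_0,\dots,v_{m-1})\in\mathrm{Good}(k_i)$ and all played indices $j_0,\dots,j_{m-1}\geq i$: $\mathcal A\models\varphi(a_{j_0},\dots,a_{j_{m-1}})\Rightarrow\mathcal B\models\mathrm{Appr}(\varphi,\varepsilon_i)(b_{j_0},\dots,b_{j_{m-1}})$. *)

theory Defs
  imports "HOL-Analysis.Analysis"
begin

unbundle cardinal_syntax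

section \<open>Vocabularies, structures and atomic formulas\<close>

record ('f, 'r) vocabulary =
  Funs :: "'f set"
  fun_arity :: "'f \<Rightarrow> nat"
  Rels :: "'r set"
  rel_arity :: "'r \<Rightarrow> nat"

datatype 'f trm = Var nat | App 'f "'f trm list"

text \<open>There is no equality symbol, so the atomic formulas are exactly those of the form
  \<open>R(t\<^sub>1, \<dots>, t\<^sub>n)\<close>.\<close>

datatype ('f, 'r) atom = Atom 'r "'f trm list"

fun wf_trm :: "('f, 'r) vocabulary \<Rightarrow> 'f trm \<Rightarrow> bool" where
  "wf_trm L (Var v) \<longleftrightarrow> True"
| "wf_trm L (App f ts) \<longleftrightarrow> f \<in> Funs L \<and> length ts = fun_arity L f \<and> (\<forall>t\<in>set ts. wf_trm L t)"

fun trm_vars :: "'f trm \<Rightarrow> nat set" where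
  "trm_vars (Var v) = {v}"
| "trm_vars (App f ts) = (\<Union>t\<in>set ts. trm_vars t)"

fun vars :: "('f, 'r) atom \<Rightarrow> nat set" where
  "vars (Atom R ts) = (\<Union>t\<in>set ts. trm_vars t)"

definition atomic_formulas :: "('f, 'r) vocabulary \<Rightarrow> ('f, 'r) atom set" where
  "atomic_formulas L =
    {Atom R ts | R ts. R \<in> Rels L \<and> length ts = rel_arity L R \<and> (\<forall>t\<in>set ts. wf_trm L t)}"

record ('f, 'r, 'a) L_structure =
  Univ :: "'a set"
  fun_interp :: "'f \<Rightarrow> 'a list \<Rightarrow> 'a"
  rel_interp :: "'r \<Rightarrow> 'a list \<Rightarrow> bool"

definition is_structure :: "('f, 'r) vocabulary \<Rightarrow> ('f, 'r, 'a) L_structure \<Rightarrow> bool" where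
  "is_structure L A \<longleftrightarrow> Univ A \<noteq> {} \<and>
    (\<forall>f\<in>Funs L. \<forall>as\<in>lists (Univ A). length as = fun_arity L f \<longrightarrow> fun_interp A f as \<in> Univ A)"

fun trm_val :: "('f, 'r, 'a) L_structure \<Rightarrow> (nat \<Rightarrow> 'a) \<Rightarrow> 'f trm \<Rightarrow> 'a" where
  "trm_val A s (Var v) = s v"
| "trm_val A s (App f ts) = fun_interp A f (map (trm_val A s) ts)"

text \<open>\<open>\<A> \<Turnstile> \<phi>(a)\<close> is \<open>sat A s \<phi>\<close>, where the assignment \<open>s\<close> sends the variable \<open>v\<^sub>i\<close> to \<open>a\<^sub>i\<close>.\<close>

fun sat :: "('f, 'r, 'a) L_structure \<Rightarrow> (nat \<Rightarrow> 'a) \<Rightarrow> ('f, 'r) atom \<Rightarrow> bool" where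
  "sat A s (Atom R ts) \<longleftrightarrow> rel_interp A R (map (trm_val A s) ts)"

definition assignments :: "('f, 'r, 'a) L_structure \<Rightarrow> (nat \<Rightarrow> 'a) set" where
  "assignments A = {s. \<forall>v. s v \<in> Univ A}"

definition is_L_isomorphism ::
  "('f, 'r) vocabulary \<Rightarrow> ('f, 'r, 'a) L_structure \<Rightarrow> ('f, 'r, 'a) L_structure \<Rightarrow> ('a \<Rightarrow> 'a) \<Rightarrow> bool" where
  "is_L_isomorphism L A B h \<longleftrightarrow> bij_betw h (Univ A) (Univ B) \<and>
    (\<forall>f\<in>Funs L. \<forall>as\<in>lists (Univ A). length as = fun_arity L f \<longrightarrow>
       h (fun_interp A f as) = fun_interp B f (map h as)) \<and>
    (\<forall>R\<in>Rels L. \<forall>as\<in>lists (Univ A). length as = rel_arity L R \<longrightarrow>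
       (rel_interp A R as \<longleftrightarrow> rel_interp B R (map h as)))"

text \<open>Entailment and equivalence are relative to the class \<open>K\<close>.\<close>

definition entails ::
  "('f, 'r, 'a) L_structure set \<Rightarrow> ('f, 'r) atom \<Rightarrow> ('f, 'r) atom \<Rightarrow> bool" where
  "entails K \<phi> \<psi> \<longleftrightarrow> (\<forall>A\<in>K. \<forall>s\<in>assignments A. sat A s \<phi> \<longrightarrow> sat A s \<psi>)"

definition equivalent ::
  "('f, 'r, 'a) L_structure set \<Rightarrow> ('f, 'r) atom \<Rightarrow> ('f, 'r) atom \<Rightarrow> bool" where
  "equivalent K \<phi> \<psi> \<longleftrightarrow> (\<forall>A\<in>K. \<forall>s\<in>assignments A. sat A s \<phi> \<longleftrightarrow> sat A s \<psi>)"


section \<open>Approximations, metrics, isomorphism notions, good vocabularies\<close>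

text \<open>In \<open>Appr_neg_Appr\<close> the formula \<open>Appr \<phi> (\<epsilon> - \<delta>)\<close> has to be defined, and \<open>Appr\<close> is defined
  for parameters in \<open>D\<close> only; hence the clause includes \<open>\<epsilon> - \<delta> \<in> D\<close>.\<close>

locale vocabulary_with_approximations =
  fixes L :: "('f, 'r) vocabulary"
    and K :: "('f, 'r, 'a) L_structure set"
    and D :: "real set"
    and Appr :: "('f, 'r) atom \<Rightarrow> real \<Rightarrow> ('f, 'r) atom"
    and neg :: "('f, 'r) atom \<Rightarrow> ('f, 'r) atom"
  assumes structures: "A \<in> K \<Longrightarrow> is_structure L A"
    and D_nonneg: "D \<subseteq> {0..}"
    and D_dense: "{0..} \<subseteq> closure D"
    and zero_in_D: "0 \<in> D"
    and D_add: "\<lbrakk>\<epsilon> \<in> D; \<delta> \<in> D\<rbrakk> \<Longrightarrow> \<epsilon> + \<delta> \<in> D"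
    and Appr_atomic: "\<lbrakk>\<phi> \<in> atomic_formulas L; \<epsilon> \<in> D\<rbrakk> \<Longrightarrow> Appr \<phi> \<epsilon> \<in> atomic_formulas L"
    and neg_atomic: "\<phi> \<in> atomic_formulas L \<Longrightarrow> neg \<phi> \<in> atomic_formulas L"
    and Appr_vars: "\<lbrakk>\<phi> \<in> atomic_formulas L; \<epsilon> \<in> D\<rbrakk> \<Longrightarrow> vars (Appr \<phi> \<epsilon>) = vars \<phi>"
    and neg_vars: "\<phi> \<in> atomic_formulas L \<Longrightarrow> vars (neg \<phi>) = vars \<phi>"
    and Appr_zero: "\<phi> \<in> atomic_formulas L \<Longrightarrow> equivalent K (Appr \<phi> 0) \<phi>"
    and Appr_Appr: "\<lbrakk>\<phi> \<in> atomic_formulas L; \<epsilon> \<in> D; \<delta> \<in> D\<rbrakk>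
      \<Longrightarrow> equivalent K (Appr (Appr \<phi> \<epsilon>) \<delta>) (Appr \<phi> (\<epsilon> + \<delta>))"
    and entails_Appr: "\<lbrakk>\<phi> \<in> atomic_formulas L; \<epsilon> \<in> D\<rbrakk> \<Longrightarrow> entails K \<phi> (Appr \<phi> \<epsilon>)"
    and sat_iff_Appr: "\<lbrakk>\<phi> \<in> atomic_formulas L; A \<in> K; s \<in> assignments A\<rbrakk>
      \<Longrightarrow> sat A s \<phi> \<longleftrightarrow> (\<forall>\<epsilon>\<in>D - {0}. sat A s (Appr \<phi> \<epsilon>))"
    and neg_neg: "\<phi> \<in> atomic_formulas L \<Longrightarrow> neg (neg \<phi>) = \<phi>"
    and not_sat_iff_neg_Appr: "\<lbrakk>\<phi> \<in> atomic_formulas L; A \<in> K; s \<in> assignments A\<rbrakk>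
      \<Longrightarrow> \<not> sat A s \<phi> \<longleftrightarrow> (\<exists>\<epsilon>\<in>D - {0}. sat A s (neg (Appr \<phi> \<epsilon>)))"
    and Appr_neg_Appr: "\<lbrakk>\<phi> \<in> atomic_formulas L; \<epsilon> \<in> D; \<delta> \<in> D; \<epsilon> \<ge> \<delta>; \<delta> > 0\<rbrakk>
      \<Longrightarrow> \<epsilon> - \<delta> \<in> D \<and> equivalent K (Appr (neg (Appr \<phi> \<epsilon>)) \<delta>) (neg (Appr \<phi> (\<epsilon> - \<delta>)))"

locale metric_structures = vocabulary_with_approximations L K D Appr neg
  for L :: "('f, 'r) vocabulary" and K :: "('f, 'r, 'a) L_structure set" and D Appr neg +
  fixes dst :: "('f, 'r, 'a) L_structure \<Rightarrow> 'a \<Rightarrow> 'a \<Rightarrow> real"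
  assumes metric: "A \<in> K \<Longrightarrow> Metric_space (Univ A) (dst A)"
    and complete: "A \<in> K \<Longrightarrow> Metric_space.mcomplete (Univ A) (dst A)"
    and dst_definable: "\<lbrakk>A \<in> K; r \<in> D\<rbrakk> \<Longrightarrow>
      \<exists>\<phi>\<in>atomic_formulas L. vars \<phi> \<subseteq> {0, 1} \<and>
        (\<forall>s\<in>assignments A. sat A s \<phi> \<longleftrightarrow> dst A (s 0) (s 1) \<le> r)"

text \<open>\<open>Iso \<epsilon> A B\<close> consists of the members of \<open>\<I>\<^sub>\<epsilon>\<close> with domain \<open>A\<close> and codomain \<open>B\<close>; a map of
  type \<open>'a \<Rightarrow> 'a\<close> represents its restriction to \<open>Univ A\<close>.\<close>

locale isomorphism_notion = metric_structures L K D Appr neg dst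
  for L :: "('f, 'r) vocabulary" and K :: "('f, 'r, 'a) L_structure set" and D Appr neg dst +
  fixes Iso :: "real \<Rightarrow> ('f, 'r, 'a) L_structure \<Rightarrow> ('f, 'r, 'a) L_structure \<Rightarrow> ('a \<Rightarrow> 'a) set"
  assumes Iso_bij: "\<lbrakk>\<epsilon> \<in> D; A \<in> K; B \<in> K; f \<in> Iso \<epsilon> A B\<rbrakk> \<Longrightarrow> bij_betw f (Univ A) (Univ B)"
    and Iso_zero: "\<lbrakk>A \<in> K; B \<in> K; is_L_isomorphism L A B f\<rbrakk> \<Longrightarrow> f \<in> Iso 0 A B"
    and Iso_inverse: "\<lbrakk>\<epsilon> \<in> D; A \<in> K; B \<in> K; f \<in> Iso \<epsilon> A B\<rbrakk>
      \<Longrightarrow> inv_into (Univ A) f \<in> Iso \<epsilon> B A"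
    and Iso_comp: "\<lbrakk>\<epsilon> \<in> D; \<epsilon>' \<in> D; A \<in> K; B \<in> K; C \<in> K; f \<in> Iso \<epsilon> A B; g \<in> Iso \<epsilon>' B C\<rbrakk>
      \<Longrightarrow> g \<circ> f \<in> Iso (\<epsilon> + \<epsilon>') A C"
    and Iso_mono: "\<lbrakk>\<epsilon> \<in> D; \<epsilon>' \<in> D; \<epsilon> \<le> \<epsilon>'; A \<in> K; B \<in> K\<rbrakk> \<Longrightarrow> Iso \<epsilon> A B \<subseteq> Iso \<epsilon>' A B"
    and Iso_iff: "\<lbrakk>\<epsilon> \<in> D; A \<in> K; B \<in> K; f ` Univ A = Univ B\<rbrakk> \<Longrightarrow> f \<in> Iso \<epsilon> A B \<longleftrightarrow>
      (\<forall>\<phi>\<in>atomic_formulas L. \<forall>s\<in>assignments A. sat A s \<phi> \<longrightarrow> sat B (f \<circ> s) (Appr \<phi> \<epsilon>))"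

text \<open>\<open>transfers Appr A B G \<epsilon> J a b\<close> says that \<open>A \<Turnstile> \<phi>(a\<^bsub>i_0\<^esub>, \<dots>)\<close> implies
  \<open>B \<Turnstile> Appr(\<phi>, \<epsilon>)(b\<^bsub>i_0\<^esub>, \<dots>)\<close> for all \<open>\<phi> \<in> G\<close> and all indices \<open>i_0, \<dots>\<close> from \<open>J\<close>.\<close>

definition transfers ::
  "(('f, 'r) atom \<Rightarrow> real \<Rightarrow> ('f, 'r) atom) \<Rightarrow> ('f, 'r, 'a) L_structure \<Rightarrow> ('f, 'r, 'a) L_structure \<Rightarrow>
   ('f, 'r) atom set \<Rightarrow> real \<Rightarrow> nat set \<Rightarrow> (nat \<Rightarrow> 'a) \<Rightarrow> (nat \<Rightarrow> 'a) \<Rightarrow> bool" where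
  "transfers Appr A B G \<epsilon> J a b \<longleftrightarrow>
    (\<forall>\<phi>\<in>G. \<forall>\<iota>. (\<forall>v\<in>vars \<phi>. \<iota> v \<in> J) \<longrightarrow>
       sat A (\<lambda>v. a (\<iota> v)) \<phi> \<longrightarrow> sat B (\<lambda>v. b (\<iota> v)) (Appr \<phi> \<epsilon>))"

locale good_vocabulary = isomorphism_notion L K D Appr neg dst Iso
  for L :: "('f, 'r) vocabulary" and K :: "('f, 'r, 'a) L_structure set" and D Appr neg dst Iso +
  fixes Good :: "nat \<Rightarrow> ('f, 'r) atom set"
  assumes Good_atomic: "Good k \<subseteq> atomic_formulas L"
    and Good_exhausts: "\<phi> \<in> atomic_formulas L \<Longrightarrow> \<exists>k. \<exists>\<psi>\<in>Good k. equivalent K \<phi> \<psi>"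
    and Good_Suc: "Good k \<subseteq> Good (Suc k)"
    and Good_Appr: "\<lbrakk>\<phi> \<in> Good k; \<epsilon> \<in> D\<rbrakk> \<Longrightarrow>
      Appr \<phi> \<epsilon> \<in> Good (nat \<lceil>real k * exp \<epsilon>\<rceil>) \<and> neg (Appr \<phi> \<epsilon>) \<in> Good (nat \<lceil>real k * exp \<epsilon>\<rceil>)"
    and Good_continuous: "\<lbrakk>A \<in> K; \<epsilon> \<in> D; \<epsilon> > 0\<rbrakk> \<Longrightarrow>
      \<exists>\<delta>\<in>D. \<delta> > 0 \<and>
        (\<forall>\<phi>\<in>Good k. \<forall>s\<in>assignments A. \<forall>t\<in>assignments A.
           (\<forall>v\<in>vars \<phi>. dst A (s v) (t v) < \<delta>) \<longrightarrow> sat A s \<phi> \<longrightarrow> sat A t (Appr \<phi> \<epsilon>))"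
    and Good_Cauchy: "\<lbrakk>A \<in> K; B \<in> K; range a \<subseteq> Univ A; range b \<subseteq> Univ B;
        \<epsilon> \<in> D; \<And>n. e n \<in> D; \<And>n. e n > \<epsilon>; \<And>n. e (Suc n) < e n; e \<longlonglongrightarrow> \<epsilon>;
        \<And>k. transfers Appr A B (Good k) (e k) {k..} a b; strict_mono (i :: nat \<Rightarrow> nat)\<rbrakk> \<Longrightarrow>
      Metric_space.MCauchy (Univ A) (dst A) (a \<circ> i) \<longleftrightarrow> Metric_space.MCauchy (Univ B) (dst B) (b \<circ> i)"


section \<open>Games\<close>

text \<open>\<open>Inl\<close> marks the elements of \<open>A\<close> and \<open>Inr\<close> those of \<open>B\<close>, so that the structures are disjoint
  even if their universes overlap.\<close>

record 'a ef_move =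
  pick :: "'a + 'a"
  tol :: real

record ('a, 'o) efd_move = "'a ef_move" +
  level :: nat
  clock :: 'o

definition legal_pick ::
  "real set \<Rightarrow> real \<Rightarrow> ('f, 'r, 'a) L_structure \<Rightarrow> ('f, 'r, 'a) L_structure \<Rightarrow> ('a, 'z) ef_move_scheme \<Rightarrow> bool"
  where
  "legal_pick D \<epsilon> A B m \<longleftrightarrow> pick m \<in> Univ A <+> Univ B \<and> tol m \<in> D \<and> tol m > \<epsilon>"

text \<open>A strategy of player II maps the nonempty list \<open>h\<close> of the moves made by I so far to II's answer
  to the last of them.\<close>

definition legal_answer ::
  "('f, 'r, 'a) L_structure \<Rightarrow> ('f, 'r, 'a) L_structure \<Rightarrow> (('a, 'z) ef_move_scheme list \<Rightarrow> 'a) \<Rightarrow>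
   ('a, 'z) ef_move_scheme list \<Rightarrow> bool" where
  "legal_answer A B \<tau> h \<longleftrightarrow> (case pick (last h) of Inl _ \<Rightarrow> \<tau> h \<in> Univ B | Inr _ \<Rightarrow> \<tau> h \<in> Univ A)"

definition left_elem ::
  "(('a, 'z) ef_move_scheme list \<Rightarrow> 'a) \<Rightarrow> ('a, 'z) ef_move_scheme list \<Rightarrow> 'a" where
  "left_elem \<tau> h = (case pick (last h) of Inl x \<Rightarrow> x | Inr _ \<Rightarrow> \<tau> h)"

definition right_elem ::
  "(('a, 'z) ef_move_scheme list \<Rightarrow> 'a) \<Rightarrow> ('a, 'z) ef_move_scheme list \<Rightarrow> 'a" where
  "right_elem \<tau> h = (case pick (last h) of Inl _ \<Rightarrow> \<tau> h | Inr y \<Rightarrow> y)"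

definition II_wins_EF ::
  "real set \<Rightarrow> (('f, 'r) atom \<Rightarrow> real \<Rightarrow> ('f, 'r) atom) \<Rightarrow> (nat \<Rightarrow> ('f, 'r) atom set) \<Rightarrow>
   real \<Rightarrow> ('f, 'r, 'a) L_structure \<Rightarrow> ('f, 'r, 'a) L_structure \<Rightarrow> bool" where
  "II_wins_EF D Appr Good \<epsilon> A B \<longleftrightarrow>
    (\<exists>\<tau> :: 'a ef_move list \<Rightarrow> 'a. \<forall>p :: nat \<Rightarrow> 'a ef_move.
       (\<forall>k. legal_pick D \<epsilon> A B (p k)) \<longrightarrow>
       (\<forall>k. legal_answer A B \<tau> (map p [0..<Suc k])) \<and>
       (\<forall>k. transfers Appr A B (Good k) (tol (p k)) {k..}
              (\<lambda>j. left_elem \<tau> (map p [0..<Suc j])) (\<lambda>j. right_elem \<tau> (map p [0..<Suc j]))))"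

text \<open>The ordinal \<open>\<alpha>\<close> is given as a well-order and the ordinals below it as the elements of its
  field. Since the clock values strictly decrease, I always reaches \<open>0\<close> after finitely many rounds,
  and the complete plays are the lists in which exactly the last clock value is \<open>0\<close>, the element
  without predecessors. For \<open>\<alpha> = 0\<close> there are no complete plays and II wins. Up to isomorphism, every
  ordinal below \<open>cardSuc \<kappa>\<close> is a well-order on the type over which \<open>cardSuc \<kappa>\<close> is defined.\<close>

definition complete_EFD_play ::
  "real set \<Rightarrow> 'o rel \<Rightarrow> real \<Rightarrow> ('f, 'r, 'a) L_structure \<Rightarrow> ('f, 'r, 'a) L_structure \<Rightarrow>
   ('a, 'o) efd_move list \<Rightarrow> bool" where
  "complete_EFD_play D \<alpha> \<epsilon> A B p \<longleftrightarrow>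
    (\<forall>m\<in>set p. legal_pick D \<epsilon> A B m \<and> clock m \<in> Field \<alpha>) \<and>
    (\<forall>i<length p. \<forall>j<i. (clock (p ! i), clock (p ! j)) \<in> \<alpha> - Id) \<and>
    p \<noteq> [] \<and> underS \<alpha> (clock (last p)) = {}"

definition II_wins_EFD ::
  "real set \<Rightarrow> (('f, 'r) atom \<Rightarrow> real \<Rightarrow> ('f, 'r) atom) \<Rightarrow> (nat \<Rightarrow> ('f, 'r) atom set) \<Rightarrow>
   'o rel \<Rightarrow> real \<Rightarrow> ('f, 'r, 'a) L_structure \<Rightarrow> ('f, 'r, 'a) L_structure \<Rightarrow> bool" where
  "II_wins_EFD D Appr Good \<alpha> \<epsilon> A B \<longleftrightarrow>
    (\<exists>\<tau> :: ('a, 'o) efd_move list \<Rightarrow> 'a. \<forall>p.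
       complete_EFD_play D \<alpha> \<epsilon> A B p \<longrightarrow>
       (\<forall>i<length p. legal_answer A B \<tau> (take (Suc i) p)) \<and>
       (\<forall>i<length p. transfers Appr A B (Good (level (p ! i))) (tol (p ! i)) {i..<length p}
              (\<lambda>j. left_elem \<tau> (take (Suc j) p)) (\<lambda>j. right_elem \<tau> (take (Suc j) p))))"


section \<open>Density character\<close>

definition is_dense_in :: "'a topology \<Rightarrow> 'a set \<Rightarrow> bool" where
  "is_dense_in X S \<longleftrightarrow> S \<subseteq> topspace X \<and> X closure_of S = topspace X"

definition density_character :: "'a topology \<Rightarrow> 'a rel" where
  "density_character X =
    |SOME S. is_dense_in X S \<and> (\<forall>T. is_dense_in X T \<longrightarrow> |S| \<le>o |T| )|"

lemma density_character_attained:
  "\<exists>S. is_dense_in X S \<and> (\<forall>T. is_dense_in X T \<longrightarrow> |S| \<le>o |T| ) \<and> density_character X = |S|"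
proof -
  let ?S = "SOME S. is_dense_in X S \<and> (\<forall>T. is_dense_in X T \<longrightarrow> |S| \<le>o |T| )"
  define R where "R = card_of ` {S. is_dense_in X S}"
  have "is_dense_in X (topspace X)"
    by (simp add: is_dense_in_def)
  then have "R \<noteq> {}" unfolding R_def by blast
  moreover have "\<forall>r\<in>R. Card_order r"
    unfolding R_def using card_of_Card_order by blast
  ultimately have "\<exists>r\<in>R. \<forall>r'\<in>R. r \<le>o r'"
    by (rule exists_minim_Card_order)
  then obtain S where "is_dense_in X S" "\<forall>r\<in>R. |S| \<le>o r"
    unfolding R_def by blast
  then have "\<exists>S. is_dense_in X S \<and> (\<forall>T. is_dense_in X T \<longrightarrow> |S| \<le>o |T| )"
    unfolding R_def by blast
  from someI_ex[OF this] have "is_dense_in X ?S \<and> (\<forall>T. is_dense_in X T \<longrightarrow> |?S| \<le>o |T| )" .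
  then show ?thesis
    unfolding density_character_def by (intro exI[of _ ?S] conjI refl) (elim conjE, assumption)+
qed

definition dens ::
  "(('f, 'r, 'a) L_structure \<Rightarrow> 'a \<Rightarrow> 'a \<Rightarrow> real) \<Rightarrow> ('f, 'r, 'a) L_structure \<Rightarrow> 'a rel" where
  "dens dst A = density_character (Metric_space.mtopology (Univ A) (dst A))"

end

theory Submission
  imports Defs
begin

text \<open>Let \<open>\<kappa> = dens A + dens B\<close>. If \<open>\<kappa>\<close> is infinite, II plays the infinite game keeping the current
  position winning in the dynamic game for every clock below \<open>\<kappa>\<^sup>+\<close>. After a move of I, every clock
  has some winning answer; these answers may lie outside the dense sets, but each is close to an
  element of one of the dense sets, so by regularity of \<open>\<kappa>\<^sup>+\<close> one element \<open>c\<close> is close to winning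
  answers for unboundedly many clocks. By uniform continuity of the formulas in \<open>Good k\<close>, answering
  \<open>c\<close> itself costs an arbitrarily small amount in the constraints of the earlier rounds. II can
  afford this in every round because he plays the dynamic game with strictly smaller tolerances and
  larger levels than demanded, and the slack never runs out.

  If \<open>\<kappa>\<close> is finite, so are \<open>A\<close> and \<open>B\<close>, and regularity fails. But then \<open>\<kappa>\<close> rounds of the dynamic game
  suffice to play all elements of both structures. As there are only finitely many relations between
  \<open>A\<close> and \<open>B\<close>, one of them works for all levels and tolerances, and II follows it.\<close>

section \<open>Locality of satisfaction\<close>

lemma trm_val_cong: "(\<And>v. v \<in> trm_vars t \<Longrightarrow> s v = s' v) \<Longrightarrow> trm_val A s t = trm_val A s' t"
proof (induction t)
  case (App f ts)
  then have "map (trm_val A s) ts = map (trm_val A s') ts" by (auto cong: map_cong)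
  then show ?case by (simp only: trm_val.simps)
qed simp

lemma sat_cong:
  assumes "\<And>v. v \<in> vars \<phi> \<Longrightarrow> s v = s' v"
  shows "sat A s \<phi> = sat A s' \<phi>"
proof (cases \<phi>)
  case (Atom R ts)
  then have "map (trm_val A s) ts = map (trm_val A s') ts"
    using assms by (auto intro!: trm_val_cong)
  then show ?thesis using Atom by (simp only: sat.simps)
qed

lemma finite_trm_vars: "finite (trm_vars t)"
  by (induction t) auto

lemma finite_vars: "finite (vars \<phi>)"
  by (cases \<phi>) (simp add: finite_trm_vars)

lemma transfersD:
  assumes "transfers Appr A B G t J a b" "\<phi> \<in> G" "\<And>v. v \<in> vars \<phi> \<Longrightarrow> \<iota> v \<in> J"
    "sat A (\<lambda>v. a (\<iota> v)) \<phi>"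
  shows "sat B (\<lambda>v. b (\<iota> v)) (Appr \<phi> t)"
  using assms unfolding transfers_def by blast

section \<open>Well-orders and regularity of successor cardinals\<close>

text \<open>Serves to pick the largest clock when only finitely many are left: passing to
  \<open>g\<close> uses up no clock but \<open>g\<close> itself.\<close>

lemma finite_subset_has_max:
  assumes "Well_order r" "finite S" "S \<noteq> {}" "S \<subseteq> Field r"
  shows "\<exists>g\<in>S. S \<subseteq> insert g (underS r g)"
  using assms(2-4)
proof (induction S rule: finite_ne_induct)
  case (insert x F)
  then obtain g where g: "g \<in> F" "F \<subseteq> insert g (underS r g)" by auto
  have tr: "trans r" and tot: "Total r" and rf: "Refl r" and an: "antisym r"
    using assms(1) by (auto simp: order_on_defs)
  show ?case
  proof (cases "(x, g) \<in> r")
    case True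
    then show ?thesis using g by (auto simp: underS_def)
  next
    case False
    then have gx: "(g, x) \<in> r" using tot rf g(1) insert.prems
      by (metis insert_subset refl_on_def subsetD total_on_def)
    have "F \<subseteq> underS r x"
    proof
      fix f assume f: "f \<in> F"
      have "(f, g) \<in> r" using g f rf insert.prems by (auto simp: underS_def refl_on_def)
      then have "(f, x) \<in> r" using gx tr by (metis transD)
      moreover have "f \<noteq> x" using insert.hyps f by auto
      ultimately show "f \<in> underS r x" by (auto simp: underS_def)
    qed
    then show ?thesis by auto
  qed
qed (auto simp: underS_def)

text \<open>Otherwise every \<open>c\<close> in \<open>S\<close> fails at some \<open>f c\<close>.
  By regularity of \<open>cardSuc \<kappa>\<close> these at most \<kappa> many points have an upper
  bound \<open>i\<close>, and the \<open>c\<close> that \<open>ex\<close> provides at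
  \<open>i\<close> would by \<open>anti\<close> satisfy \<open>P (f c) c\<close> as well.\<close>

lemma cardSuc_pigeonhole:
  assumes \<kappa>: "Cinfinite \<kappa>" and S: "|S| \<le>o \<kappa>"
    and anti: "\<And>\<beta> \<gamma> c. (\<gamma>, \<beta>) \<in> cardSuc \<kappa> \<Longrightarrow> P \<beta> c \<Longrightarrow> P \<gamma> c"
    and ex: "\<And>\<beta>. \<beta> \<in> Field (cardSuc \<kappa>) \<Longrightarrow> \<exists>c\<in>S. P \<beta> c"
  shows "\<exists>c\<in>S. \<forall>\<beta>\<in>Field (cardSuc \<kappa>). P \<beta> c"
proof (rule ccontr)
  let ?r = "cardSuc \<kappa>"
  assume "\<not> ?thesis"
  then obtain f where f: "\<And>c. c \<in> S \<Longrightarrow> f c \<in> Field ?r \<and> \<not> P (f c) c"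
    by metis
  have wo: "Well_order ?r" using \<kappa> cardSuc_Card_order by (metis card_order_on_def)
  then have tr: "trans ?r" and rf: "Refl ?r" by (auto simp: order_on_defs)
  \<comment> \<open>The candidates whose failure point is at most \<open>i\<close>. They form an
    increasing chain that covers \<open>S\<close>, so by regularity a single member covers
    it.\<close>
  define As where "As i = {c \<in> S. (f c, i) \<in> ?r}" for i
  have "relChain ?r As" unfolding relChain_def As_def using tr by (auto dest: transD)
  moreover have "S \<subseteq> (\<Union>i\<in>Field ?r. As i)"
    using f rf unfolding As_def by (auto simp: refl_on_def)
  ultimately obtain i where i: "i \<in> Field ?r" "S \<subseteq> As i"
    using cardSuc_UNION_Cinfinite[OF \<kappa> _ _ S] by blast
  then obtain c where "c \<in> S" "P i c" using ex by blast
  then show False using i(2) anti f unfolding As_def by blast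
qed

section \<open>Rounds as pairs of elements\<close>

text \<open>A round is recorded as its element of \<open>A\<close> paired with its element of
  \<open>B\<close>, whichever player chose which. Positions thus become plain lists of
  pairs.\<close>

definition answers :: "('f, 'r, 'a) L_structure \<Rightarrow> ('f, 'r, 'a) L_structure \<Rightarrow> 'a + 'a \<Rightarrow> ('a \<times> 'a) set" where
  "answers A B x = (case x of Inl a \<Rightarrow> {a} \<times> Univ B | Inr b \<Rightarrow> Univ A \<times> {b})"

lemma answers_simps [simp]:
  "answers A B (Inl a) = {a} \<times> Univ B" "answers A B (Inr b) = Univ A \<times> {b}"
  by (simp_all add: answers_def)

lemma answers_subset: "x \<in> Univ A <+> Univ B \<Longrightarrow> answers A B x \<subseteq> Univ A \<times> Univ B"
  by auto

lemma answers_iff_legal_answer: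
  assumes "pick (last h) \<in> Univ A <+> Univ B"
  shows "(left_elem \<tau> h, right_elem \<tau> h) \<in> answers A B (pick (last h)) \<longleftrightarrow> legal_answer A B \<tau> h"
  by (auto simp: answers_def left_elem_def right_elem_def legal_answer_def split: sum.split)

section \<open>Approximations in a fixed pair of structures\<close>

locale EF_games = good_vocabulary L K D Appr neg dst Iso Good
  for L :: "('f, 'r) vocabulary" and K :: "('f, 'r, 'a) L_structure set"
    and D Appr neg dst Iso Good +
  fixes A B :: "('f, 'r, 'a) L_structure" and \<epsilon> :: real
  assumes A_in: "A \<in> K" and B_in: "B \<in> K" and eps_in: "\<epsilon> \<in> D"
begin

lemma Univ_nonempty: "C \<in> K \<Longrightarrow> Univ C \<noteq> {}"
  using structures by (auto simp: is_structure_def)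

lemma D_between:
  assumes "0 \<le> a" "a < b"
  obtains d where "d \<in> D" "a < d" "d < b"
proof -
  have "(a + b) / 2 \<in> closure D" using D_dense assms by auto
  then obtain d where "d \<in> D" "dist d ((a + b) / 2) < (b - a) / 2"
    using assms closure_approachable[of "(a + b) / 2" D] by (metis diff_gt_0_iff_gt half_gt_zero)
  then show ?thesis using that[of d] by (auto simp: dist_real_def abs_less_iff field_simps)
qed

text \<open>\<open>Appr_neg_Appr\<close> yields this only in the presence of an atomic formula, and
  \<open>dst_definable\<close> provides one. The case \<open>b = 0\<close>, excluded there by
  positivity, is trivial.\<close>

lemma D_diff: "\<lbrakk>a \<in> D; b \<in> D; b \<le> a\<rbrakk> \<Longrightarrow> a - b \<in> D"
  using dst_definable[OF A_in zero_in_D] Appr_neg_Appr D_nonneg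
  by (cases "b = 0") (force simp: less_le)+

lemma eps_nonneg: "0 \<le> \<epsilon>" using D_nonneg eps_in by auto

text \<open>The axioms speak of total assignments, whereas reading off a finite position makes sense
  only for the variables that occur in \<open>\<phi>\<close>.\<close>

definition values_in :: "('f, 'r, 'a) L_structure \<Rightarrow> (nat \<Rightarrow> 'a) \<Rightarrow> ('f, 'r) atom \<Rightarrow> bool" where
  "values_in C s \<phi> \<longleftrightarrow> (\<forall>v\<in>vars \<phi>. s v \<in> Univ C)"

lemma extend_assignment:
  assumes "C \<in> K" "values_in C s \<phi>"
  obtains s' where "s' \<in> assignments C" "\<And>v. v \<in> vars \<phi> \<Longrightarrow> s' v = s v"
proof -
  \<comment> \<open>A default value for the variables outside \<open>\<phi>\<close>; universes are
    nonempty.\<close>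
  obtain c where "c \<in> Univ C" using Univ_nonempty assms by blast
  with assms(2) show ?thesis
    by (intro that[of "\<lambda>v. if v \<in> vars \<phi> then s v else c"])
      (auto simp: assignments_def values_in_def)
qed

lemma sat_Appr_Appr:
  assumes "C \<in> K" "values_in C s \<phi>" "\<phi> \<in> atomic_formulas L" "a \<in> D" "b \<in> D"
  shows "sat C s (Appr (Appr \<phi> a) b) \<longleftrightarrow> sat C s (Appr \<phi> (a + b))"
proof -
  obtain s' where s': "s' \<in> assignments C" "\<And>v. v \<in> vars \<phi> \<Longrightarrow> s' v = s v"
    using extend_assignment assms by metis
  have "sat C s' (Appr (Appr \<phi> a) b) \<longleftrightarrow> sat C s' (Appr \<phi> (a + b))"
    using Appr_Appr[OF assms(3-5)] s'(1) assms(1) by (auto simp: equivalent_def)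
  moreover have "sat C s' \<psi> = sat C s \<psi>" if "vars \<psi> = vars \<phi>" for \<psi>
    using sat_cong s'(2) that by metis
  ultimately show ?thesis using assms by (simp add: Appr_vars Appr_atomic D_add)
qed

lemma sat_Appr:
  assumes "C \<in> K" "values_in C s \<phi>" "\<phi> \<in> atomic_formulas L" "a \<in> D" "sat C s \<phi>"
  shows "sat C s (Appr \<phi> a)"
proof -
  obtain s' where s': "s' \<in> assignments C" "\<And>v. v \<in> vars \<phi> \<Longrightarrow> s' v = s v"
    using extend_assignment assms by metis
  have "sat C s' \<psi> = sat C s \<psi>" if "vars \<psi> = vars \<phi>" for \<psi>
    using sat_cong s'(2) that by metis
  then have "sat C s' \<phi> = sat C s \<phi>" "sat C s' (Appr \<phi> a) = sat C s (Appr \<phi> a)"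
    using assms by (simp_all add: Appr_vars)
  then show ?thesis using assms s'(1) entails_Appr[OF assms(3,4)]
    by (auto simp: entails_def)
qed

text \<open>Approximating \<open>Appr \<phi> a\<close> further by \<open>b - a\<close>, which lies
  in \<open>D\<close> by \<open>D_diff\<close>, amounts to \<open>Appr \<phi> b\<close>.\<close>

lemma sat_Appr_mono:
  assumes "C \<in> K" "values_in C s \<phi>" "\<phi> \<in> atomic_formulas L" "a \<in> D" "b \<in> D" "a \<le> b"
    and "sat C s (Appr \<phi> a)"
  shows "sat C s (Appr \<phi> b)"
proof -
  have ba: "b - a \<in> D" using D_diff assms by blast
  have "sat C s (Appr (Appr \<phi> a) (b - a))"
    by (rule sat_Appr[OF assms(1) _ _ ba assms(7)])
      (use assms in \<open>auto simp: values_in_def Appr_vars Appr_atomic\<close>)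
  then show ?thesis using sat_Appr_Appr[OF assms(1-4) ba] by simp
qed

lemma Good_mono: "k \<le> k' \<Longrightarrow> Good k \<subseteq> Good k'"
  by (rule lift_Suc_mono_le[of Good, OF Good_Suc])

text \<open>Uniform continuity is applied to the formulas \<open>Appr \<phi> a\<close>. For \<phi>
  in \<open>Good k\<close> they all lie in one larger level, so one \<delta> serves all of
  them.\<close>

lemma Good_continuous_Appr:
  assumes "C \<in> K" "a \<in> D" "\<eta> \<in> D" "\<eta> > 0"
  obtains \<delta> where "\<delta> > 0"
    "\<And>\<phi> s t. \<lbrakk>\<phi> \<in> Good k; values_in C s \<phi>; values_in C t \<phi>;
        \<And>v. v \<in> vars \<phi> \<Longrightarrow> dst C (s v) (t v) < \<delta>; sat C s (Appr \<phi> a)\<rbrakk>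
      \<Longrightarrow> sat C t (Appr \<phi> (a + \<eta>))"
proof -
  let ?k = "nat \<lceil>real k * exp a\<rceil>"
  obtain \<delta> where \<delta>: "\<delta> > 0" "\<And>\<phi> s t. \<phi> \<in> Good ?k \<Longrightarrow> s \<in> assignments C \<Longrightarrow> t \<in> assignments C \<Longrightarrow>
      (\<forall>v\<in>vars \<phi>. dst C (s v) (t v) < \<delta>) \<Longrightarrow> sat C s \<phi> \<Longrightarrow> sat C t (Appr \<phi> \<eta>)"
    using Good_continuous[OF assms(1,3,4), of ?k] by metis
  show ?thesis
  proof (rule that[OF \<delta>(1)])
    fix \<phi> s t
    assume *: "\<phi> \<in> Good k" "values_in C s \<phi>" "values_in C t \<phi>"
      "\<And>v. v \<in> vars \<phi> \<Longrightarrow> dst C (s v) (t v) < \<delta>" "sat C s (Appr \<phi> a)"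
    have at: "\<phi> \<in> atomic_formulas L" using Good_atomic * by blast
    obtain s' where s': "s' \<in> assignments C" "\<And>v. v \<in> vars \<phi> \<Longrightarrow> s' v = s v"
      using extend_assignment assms * by metis
    obtain t' where t': "t' \<in> assignments C" "\<And>v. v \<in> vars \<phi> \<Longrightarrow> t' v = t v"
      using extend_assignment assms * by metis
    have vs: "vars (Appr \<phi> a) = vars \<phi>" "vars (Appr (Appr \<phi> a) \<eta>) = vars \<phi>"
      using at assms by (simp_all add: Appr_vars Appr_atomic)
    have "sat C s' (Appr \<phi> a)" using *(5) sat_cong[of "Appr \<phi> a" s' s] s'(2) vs by simp
    then have "sat C t' (Appr (Appr \<phi> a) \<eta>)"
      using \<delta>(2)[OF _ s'(1) t'(1)] Good_Appr[OF *(1) assms(2)] *(4) s'(2) t'(2) vs by simp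
    then have "sat C t (Appr (Appr \<phi> a) \<eta>)"
      using sat_cong[of "Appr (Appr \<phi> a) \<eta>" t' t] t'(2) vs by simp
    then show "sat C t (Appr \<phi> (a + \<eta>))"
      using sat_Appr_Appr[OF assms(1) *(3) at assms(2,3)] by simp
  qed
qed

section \<open>Winning conditions on finite positions\<close>

text \<open>The winning condition of a single round, where \<open>l\<close> is the part of the
  position from that round on, renumbered from 0.\<close>

definition constr :: "nat \<Rightarrow> real \<Rightarrow> ('a \<times> 'a) list \<Rightarrow> bool" where
  "constr k t l = transfers Appr A B (Good k) t {..<length l} (\<lambda>j. fst (l ! j)) (\<lambda>j. snd (l ! j))"

text \<open>Dropping the first \<open>i\<close> rounds shifts all indices by
  \<open>i\<close>.\<close>

lemma transfers_imp_constr: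
  assumes tr: "transfers Appr A B (Good k) t {i..<n} a b" and t: "t \<in> D" and "i \<le> n"
  shows "constr k t (drop i (map (\<lambda>j. (a j, b j)) [0..<n]))"
  unfolding constr_def transfers_def
proof (intro ballI allI impI)
  fix \<phi> \<iota>
  let ?l = "drop i (map (\<lambda>j. (a j, b j)) [0..<n])"
  assume \<phi>: "\<phi> \<in> Good k" and \<iota>: "\<forall>v\<in>vars \<phi>. \<iota> v \<in> {..<length ?l}"
    and s: "sat A (\<lambda>v. fst (?l ! \<iota> v)) \<phi>"
  have at: "\<phi> \<in> atomic_formulas L" using Good_atomic \<phi> by blast
  have eq: "?l ! \<iota> v = (a (i + \<iota> v), b (i + \<iota> v))" if "v \<in> vars \<phi>" for v
    using \<iota> that \<open>i \<le> n\<close> by (auto simp: less_diff_conv add.commute)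
  have "sat A (\<lambda>v. a (i + \<iota> v)) \<phi>"
    using s by (subst sat_cong[where s' = "\<lambda>v. fst (?l ! \<iota> v)"]) (auto simp only: eq fst_conv)
  moreover have "\<forall>v\<in>vars \<phi>. i + \<iota> v \<in> {i..<n}" using \<iota> by auto
  ultimately have "sat B (\<lambda>v. b (i + \<iota> v)) (Appr \<phi> t)"
    using transfersD[OF tr \<phi>, where \<iota> = "\<lambda>v. i + \<iota> v"] by blast
  then show "sat B (\<lambda>v. snd (?l ! \<iota> v)) (Appr \<phi> t)"
    by (subst sat_cong[where s' = "\<lambda>v. b (i + \<iota> v)"]) (auto simp only: eq snd_conv Appr_vars[OF at t])
qed

text \<open>A formula has finitely many variables, so each instance of the condition on an infinite
  play lives in a finite initial segment.\<close>

lemma constr_imp_transfers: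
  assumes c: "\<And>n. i \<le> n \<Longrightarrow> constr k t (drop i (map (\<lambda>j. (a j, b j)) [0..<n]))" and t: "t \<in> D"
  shows "transfers Appr A B (Good k) t {i..} a b"
  unfolding transfers_def
proof (intro ballI allI impI)
  fix \<phi> \<iota>
  assume \<phi>: "\<phi> \<in> Good k" and \<iota>: "\<forall>v\<in>vars \<phi>. \<iota> v \<in> {i..}" and s: "sat A (\<lambda>v. a (\<iota> v)) \<phi>"
  have at: "\<phi> \<in> atomic_formulas L" using Good_atomic \<phi> by blast
  obtain n where n: "\<And>v. v \<in> vars \<phi> \<Longrightarrow> \<iota> v < n" "i \<le> n"
  \<comment> \<open>\<open>max i\<close> covers formulas without variables, where \<open>Max\<close>
    is applied to the empty set.\<close>
  proof (rule that[of "max i (Suc (Max (\<iota> ` vars \<phi>)))"])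
    fix v assume "v \<in> vars \<phi>"
    then have "\<iota> v \<le> Max (\<iota> ` vars \<phi>)" by (intro Max_ge) (auto simp: finite_vars)
    then show "\<iota> v < max i (Suc (Max (\<iota> ` vars \<phi>)))" by auto
  qed simp
  let ?l = "drop i (map (\<lambda>j. (a j, b j)) [0..<n])"
  have eq: "?l ! (\<iota> v - i) = (a (\<iota> v), b (\<iota> v))" if "v \<in> vars \<phi>" for v
    using \<iota> n that by (auto simp: nth_append)
  have "sat A (\<lambda>v. fst (?l ! (\<iota> v - i))) \<phi>"
    using s by (subst sat_cong[where s' = "\<lambda>v. a (\<iota> v)"]) (auto simp only: eq fst_conv)
  moreover have "\<forall>v\<in>vars \<phi>. \<iota> v - i \<in> {..<length ?l}"
    using \<iota> n by (auto simp: diff_less_mono)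
  ultimately have "sat B (\<lambda>v. snd (?l ! (\<iota> v - i))) (Appr \<phi> t)"
    using transfersD[OF c[OF n(2), unfolded constr_def] \<phi>, where \<iota> = "\<lambda>v. \<iota> v - i"] by blast
  then show "sat B (\<lambda>v. b (\<iota> v)) (Appr \<phi> t)"
    by (subst sat_cong[where s' = "\<lambda>v. snd (?l ! (\<iota> v - i))"]) (auto simp only: eq snd_conv Appr_vars[OF at t])
qed

lemma constr_mono:
  assumes "constr k t l" "k' \<le> k" "t \<le> t'" "t \<in> D" "t' \<in> D" "set l \<subseteq> Univ A \<times> Univ B"
  shows "constr k' t' l"
  unfolding constr_def transfers_def
proof (intro ballI allI impI)
  fix \<phi> \<iota>
  assume *: "\<phi> \<in> Good k'" "\<forall>v\<in>vars \<phi>. \<iota> v \<in> {..<length l}" "sat A (\<lambda>v. fst (l ! \<iota> v)) \<phi>"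
  have "\<phi> \<in> Good k" using Good_mono * assms by blast
  then have "sat B (\<lambda>v. snd (l ! \<iota> v)) (Appr \<phi> t)"
    using assms(1) * unfolding constr_def transfers_def by blast
  moreover have "values_in B (\<lambda>v. snd (l ! \<iota> v)) \<phi>"
    using assms(6) *(2) by (fastforce simp: values_in_def dest: nth_mem)
  ultimately show "sat B (\<lambda>v. snd (l ! \<iota> v)) (Appr \<phi> t')"
    using sat_Appr_mono[OF B_in] assms *(1) Good_atomic by blast
qed

text \<open>The condition ranges over all index maps, repetitions included, so it depends only on
  which pairs occur. For finite structures this turns a condition on a list into one on a
  relation.\<close>

lemma constr_reindex:
  assumes "constr k t l" "set l' \<subseteq> set l" and t: "t \<in> D"
  shows "constr k t l'"
proof -
  have "\<forall>j\<in>{..<length l'}. \<exists>i<length l. l ! i = l' ! j"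
    using assms(2) by (metis in_set_conv_nth lessThan_iff nth_mem subsetD)
  then obtain f where f: "\<And>j. j < length l' \<Longrightarrow> f j < length l \<and> l ! f j = l' ! j"
    by (metis lessThan_iff)
  show ?thesis unfolding constr_def transfers_def
  proof (intro ballI allI impI)
    fix \<phi> \<iota>
    assume *: "\<phi> \<in> Good k" "\<forall>v\<in>vars \<phi>. \<iota> v \<in> {..<length l'}" "sat A (\<lambda>v. fst (l' ! \<iota> v)) \<phi>"
    show "sat B (\<lambda>v. snd (l' ! \<iota> v)) (Appr \<phi> t)"
    proof -
      have "sat A (\<lambda>v. fst (l ! f (\<iota> v))) \<phi>"
        using *(2,3) f by (subst sat_cong[where s' = "\<lambda>v. fst (l' ! \<iota> v)"]) auto
      moreover have "\<forall>v\<in>vars \<phi>. f (\<iota> v) \<in> {..<length l}" using *(2) f by auto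
      ultimately have "sat B (\<lambda>v. snd (l ! f (\<iota> v))) (Appr \<phi> t)"
        using transfersD[OF assms(1)[unfolded constr_def] *(1), where \<iota> = "\<lambda>v. f (\<iota> v)"] by blast
      moreover have "vars (Appr \<phi> t) = vars \<phi>"
        using Good_atomic *(1) t by (intro Appr_vars) auto
      ultimately show ?thesis
        using *(2) f by (subst sat_cong[where s' = "\<lambda>v. snd (l ! f (\<iota> v))"]) auto
    qed
  qed
qed


section \<open>Constraints with slack and their stability under small perturbations\<close>

text \<open>A constraint with slack on both sides: the slack \<open>s\<close> pays for moving elements of \<open>A\<close>, and the gap
  between \<open>t\<close> and the tolerance demanded by I pays for moving elements of \<open>B\<close>.\<close>

definition weak_constr :: "nat \<Rightarrow> real \<Rightarrow> real \<Rightarrow> ('a \<times> 'a) list \<Rightarrow> bool" where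
  "weak_constr k s t l \<longleftrightarrow> (\<forall>\<phi>\<in>Good k. \<forall>\<iota>. (\<forall>v\<in>vars \<phi>. \<iota> v < length l) \<longrightarrow>
     sat A (\<lambda>v. fst (l ! \<iota> v)) (Appr \<phi> s) \<longrightarrow> sat B (\<lambda>v. snd (l ! \<iota> v)) (Appr \<phi> t))"

lemma values_in_nth:
  assumes "set l \<subseteq> Univ A \<times> Univ B" "\<forall>v\<in>vars \<phi>. \<iota> v < length l"
  shows "values_in A (\<lambda>v. fst (l ! \<iota> v)) \<phi>" "values_in B (\<lambda>v. snd (l ! \<iota> v)) \<phi>"
  using assms by (fastforce simp: values_in_def dest: nth_mem)+

text \<open>This is how slack is gained: the enlarged level admits \<open>Appr \<phi> s\<close> for
  \<open>\<phi>\<close> in \<open>Good k\<close>, so the constraint applies to that formula and the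
  two tolerances add up.\<close>

lemma constr_imp_weak_constr:
  assumes c: "constr (nat \<lceil>real k * exp s\<rceil>) t l" and "s \<in> D" "t \<in> D" and l: "set l \<subseteq> Univ A \<times> Univ B"
  shows "weak_constr k s (s + t) l"
  unfolding weak_constr_def
proof (intro ballI allI impI)
  fix \<phi> \<iota>
  assume \<phi>: "\<phi> \<in> Good k" and \<iota>: "\<forall>v\<in>vars \<phi>. \<iota> v < length l"
    and s: "sat A (\<lambda>v. fst (l ! \<iota> v)) (Appr \<phi> s)"
  have at: "\<phi> \<in> atomic_formulas L" using Good_atomic \<phi> by blast
  have "sat B (\<lambda>v. snd (l ! \<iota> v)) (Appr (Appr \<phi> s) t)"
    by (rule transfersD[OF c[unfolded constr_def]])
      (use Good_Appr[OF \<phi> \<open>s \<in> D\<close>] \<iota> s at assms in \<open>auto simp: Appr_vars\<close>)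
  then show "sat B (\<lambda>v. snd (l ! \<iota> v)) (Appr \<phi> (s + t))"
    using sat_Appr_Appr[OF B_in values_in_nth(2)[OF l \<iota>] at] assms by blast
qed

lemma weak_constr_imp_constr:
  assumes c: "weak_constr k s t l" and "s \<in> D" "t \<in> D" "t' \<in> D" "t \<le> t'" and l: "set l \<subseteq> Univ A \<times> Univ B"
  shows "constr k t' l"
  unfolding constr_def transfers_def
proof (intro ballI allI impI)
  fix \<phi> \<iota>
  assume \<phi>: "\<phi> \<in> Good k" and "\<forall>v\<in>vars \<phi>. \<iota> v \<in> {..<length l}" and s: "sat A (\<lambda>v. fst (l ! \<iota> v)) \<phi>"
  then have \<iota>: "\<forall>v\<in>vars \<phi>. \<iota> v < length l" by simp
  have at: "\<phi> \<in> atomic_formulas L" using Good_atomic \<phi> by blast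
  have "sat A (\<lambda>v. fst (l ! \<iota> v)) (Appr \<phi> s)"
    using sat_Appr[OF A_in values_in_nth(1)[OF l \<iota>] at] assms s by blast
  then have "sat B (\<lambda>v. snd (l ! \<iota> v)) (Appr \<phi> t)"
    using c \<phi> \<iota> unfolding weak_constr_def by blast
  then show "sat B (\<lambda>v. snd (l ! \<iota> v)) (Appr \<phi> t')"
    using sat_Appr_mono[OF B_in values_in_nth(2)[OF l \<iota>] at] assms by blast
qed

text \<open>The order of arguments follows the use of continuity: in \<open>A\<close> from the new
  pair \<open>q\<close> back to the old pair \<open>p\<close>, in \<open>B\<close> from
  \<open>p\<close> to \<open>q\<close>.\<close>

definition near :: "real \<Rightarrow> 'a \<times> 'a \<Rightarrow> 'a \<times> 'a \<Rightarrow> bool" where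
  "near \<delta> p q \<longleftrightarrow> dst A (fst q) (fst p) < \<delta> \<and> dst B (snd p) (snd q) < \<delta>"

lemma near_refl: "p \<in> Univ A \<times> Univ B \<Longrightarrow> 0 < \<delta> \<Longrightarrow> near \<delta> p p"
  using metric[OF A_in] metric[OF B_in] by (auto simp: near_def Metric_space.mdist_zero)

text \<open>With a small \<eta>, a premise \<open>Appr \<phi> (s - \<eta>)\<close> on the new
  elements of \<open>A\<close> gives \<open>Appr \<phi> s\<close> on the old ones, and the
  conclusion reaches the new elements of \<open>B\<close> at tolerance \<open>t + \<eta>\<close>. As
  \<eta> is below both \<open>s\<close> and \<open>t' - t\<close>, slack remains on both sides. The
  distance \<delta> does not depend on the lists.\<close>

lemma weak_constr_perturb:
  assumes "s \<in> D" "0 < s" "t \<in> D" "t < t'"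
  shows "\<exists>\<delta> s' u. 0 < \<delta> \<and> s' \<in> D \<and> 0 < s' \<and> u \<in> D \<and> u < t' \<and>
    (\<forall>l l'. list_all2 (near \<delta>) l l' \<longrightarrow> set l \<subseteq> Univ A \<times> Univ B \<longrightarrow> set l' \<subseteq> Univ A \<times> Univ B \<longrightarrow>
       weak_constr k s t l \<longrightarrow> weak_constr k s' u l')"
proof -
  obtain \<eta> where \<eta>: "\<eta> \<in> D" "0 < \<eta>" "\<eta> < min s (t' - t)"
    using D_between[of 0 "min s (t' - t)"] assms by auto
  have sD: "s - \<eta> \<in> D" using D_diff \<eta> assms by simp
  obtain \<delta>1 where \<delta>1: "\<delta>1 > 0"
    "\<And>\<phi> a b. \<lbrakk>\<phi> \<in> Good k; values_in A a \<phi>; values_in A b \<phi>;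
        \<And>v. v \<in> vars \<phi> \<Longrightarrow> dst A (a v) (b v) < \<delta>1; sat A a (Appr \<phi> (s - \<eta>))\<rbrakk>
      \<Longrightarrow> sat A b (Appr \<phi> (s - \<eta> + \<eta>))"
    using Good_continuous_Appr[OF A_in sD \<eta>(1,2), of k] by metis
  obtain \<delta>2 where \<delta>2: "\<delta>2 > 0"
    "\<And>\<phi> a b. \<lbrakk>\<phi> \<in> Good k; values_in B a \<phi>; values_in B b \<phi>;
        \<And>v. v \<in> vars \<phi> \<Longrightarrow> dst B (a v) (b v) < \<delta>2; sat B a (Appr \<phi> t)\<rbrakk>
      \<Longrightarrow> sat B b (Appr \<phi> (t + \<eta>))"
    using Good_continuous_Appr[OF B_in \<open>t \<in> D\<close> \<eta>(1,2), of k] by metis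
  have "weak_constr k (s - \<eta>) (t + \<eta>) l'"
    if nr: "list_all2 (near (min \<delta>1 \<delta>2)) l l'" and l: "set l \<subseteq> Univ A \<times> Univ B"
      and l': "set l' \<subseteq> Univ A \<times> Univ B" and c: "weak_constr k s t l" for l l'
    unfolding weak_constr_def
  proof (intro ballI allI impI)
    fix \<phi> \<iota>
    assume \<phi>: "\<phi> \<in> Good k" and \<iota>': "\<forall>v\<in>vars \<phi>. \<iota> v < length l'"
      and s: "sat A (\<lambda>v. fst (l' ! \<iota> v)) (Appr \<phi> (s - \<eta>))"
    have \<iota>: "\<forall>v\<in>vars \<phi>. \<iota> v < length l" using \<iota>' nr by (simp add: list_all2_lengthD)
    have d: "dst A (fst (l' ! \<iota> v)) (fst (l ! \<iota> v)) < \<delta>1" "dst B (snd (l ! \<iota> v)) (snd (l' ! \<iota> v)) < \<delta>2"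
      if "v \<in> vars \<phi>" for v
      using list_all2_nthD[OF nr] \<iota> that by (auto simp: near_def)
    have "sat A (\<lambda>v. fst (l ! \<iota> v)) (Appr \<phi> s)"
      using \<delta>1(2)[OF \<phi> values_in_nth(1)[OF l' \<iota>'] values_in_nth(1)[OF l \<iota>] d(1) s] by simp
    then have "sat B (\<lambda>v. snd (l ! \<iota> v)) (Appr \<phi> t)"
      using c \<phi> \<iota> unfolding weak_constr_def by blast
    then show "sat B (\<lambda>v. snd (l' ! \<iota> v)) (Appr \<phi> (t + \<eta>))"
      using \<delta>2(2)[OF \<phi> values_in_nth(2)[OF l \<iota>] values_in_nth(2)[OF l' \<iota>'] d(2)] by simp
  qed
  then show ?thesis
    by (intro exI[of _ "min \<delta>1 \<delta>2"] exI[of _ "s - \<eta>"] exI[of _ "t + \<eta>"])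
      (use \<eta> sD assms \<delta>1(1) \<delta>2(1) in \<open>auto simp: D_add\<close>)
qed

section \<open>Winning positions of the dynamic game\<close>

text \<open>\<open>wins_from r \<beta> xs Q\<close>: in the dynamic game, II wins from the position \<open>xs\<close> when I may still play
  clock values below \<open>\<beta>\<close> and \<open>Q\<close> collects the constraints of the rounds played so far. A constraint of
  a new round concerns the elements from that round on only, so \<open>Q\<close> is all that depends on \<open>xs\<close>.\<close>

inductive wins_from :: "'o rel \<Rightarrow> 'o \<Rightarrow> ('a \<times> 'a) list \<Rightarrow> (('a \<times> 'a) list \<Rightarrow> bool) \<Rightarrow> bool" for r where
  wins_fromI: "Q xs \<Longrightarrow>
    (\<And>\<gamma> x t k. \<gamma> \<in> underS r \<beta> \<Longrightarrow> x \<in> Univ A <+> Univ B \<Longrightarrow> t \<in> D \<Longrightarrow> \<epsilon> < t \<Longrightarrow>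
       \<exists>p. p \<in> answers A B x \<and> wins_from r \<gamma> (xs @ [p]) (\<lambda>l. Q l \<and> constr k t (drop (length xs) l))) \<Longrightarrow>
    wins_from r \<beta> xs Q"

lemma wins_from_constraint: "wins_from r \<beta> xs Q \<Longrightarrow> Q xs"
  by (auto elim: wins_from.cases)

lemma wins_from_step:
  assumes "wins_from r \<beta> xs Q" "\<gamma> \<in> underS r \<beta>" "x \<in> Univ A <+> Univ B" "t \<in> D" "\<epsilon> < t"
  obtains p where "p \<in> answers A B x"
    "wins_from r \<gamma> (xs @ [p]) (\<lambda>l. Q l \<and> constr k t (drop (length xs) l))"
proof -
  from assms(1) show ?thesis
  proof cases
    case wins_fromI
    show ?thesis using wins_fromI(2)[OF assms(2-5), of k] that by blast
  qed
qed

text \<open>Lowering the clock only takes moves away from I.\<close>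

lemma wins_from_antimono:
  assumes "wins_from r \<beta> xs Q" "Well_order r" "(\<gamma>, \<beta>) \<in> r"
  shows "wins_from r \<gamma> xs Q"
proof (rule wins_fromI)
  show "Q xs" using assms(1) by (rule wins_from_constraint)
  have "underS r \<gamma> \<subseteq> underS r \<beta>"
    using assms(2,3) by (intro underS_incr) (auto simp: order_on_defs)
  then show "\<exists>p. p \<in> answers A B x \<and> wins_from r \<gamma>' (xs @ [p]) (\<lambda>l. Q l \<and> constr k t (drop (length xs) l))"
    if "\<gamma>' \<in> underS r \<gamma>" "x \<in> Univ A <+> Univ B" "t \<in> D" "\<epsilon> < t" for \<gamma>' x t k
    using wins_from_step[OF assms(1) _ that(2-4), of \<gamma>' k] that(1) by blast
qed

text \<open>II keeps giving the same answers. The constraint of a later round drops at least the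
  first \<open>length xs\<close> pairs, so it cannot tell \<open>xs\<close> from \<open>xs'\<close>,
  and only \<open>Q\<close> and \<open>Q'\<close> have to be compared. This permits replacing an
  answer by a nearby one.\<close>

lemma wins_from_transfer:
  assumes "wins_from r \<beta> xs Q" "length xs' = length xs"
    "\<And>zs. set zs \<subseteq> Univ A \<times> Univ B \<Longrightarrow> Q (xs @ zs) \<Longrightarrow> Q' (xs' @ zs)"
  shows "wins_from r \<beta> xs' Q'"
  using assms
proof (induction arbitrary: xs' Q' rule: wins_from.induct)
  case (wins_fromI Q xs \<beta>)
  show ?case
  proof (rule wins_from.wins_fromI)
    show "Q' xs'" using wins_fromI.prems(2)[of "[]"] wins_fromI.hyps by simp
  next
    fix \<gamma> x t k
    assume x: "\<gamma> \<in> underS r \<beta>" "x \<in> Univ A <+> Univ B" "t \<in> D" "\<epsilon> < t"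
    obtain p where p: "p \<in> answers A B x"
      and IH: "\<And>xs'' Q''. length xs'' = length (xs @ [p]) \<Longrightarrow>
         (\<And>zs. set zs \<subseteq> Univ A \<times> Univ B \<Longrightarrow>
             Q ((xs @ [p]) @ zs) \<and> constr k t (drop (length xs) ((xs @ [p]) @ zs)) \<Longrightarrow> Q'' (xs'' @ zs)) \<Longrightarrow>
         wins_from r \<gamma> xs'' Q''"
      using wins_fromI.IH[OF x, of k] by blast
    have pin: "p \<in> Univ A \<times> Univ B" using p answers_subset[OF x(2)] by blast
    have "wins_from r \<gamma> (xs' @ [p]) (\<lambda>l. Q' l \<and> constr k t (drop (length xs') l))"
    proof (rule IH)
      fix zs assume "set zs \<subseteq> Univ A \<times> Univ B"
        "Q ((xs @ [p]) @ zs) \<and> constr k t (drop (length xs) ((xs @ [p]) @ zs))"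
      then show "Q' ((xs' @ [p]) @ zs) \<and> constr k t (drop (length xs') ((xs' @ [p]) @ zs))"
        using wins_fromI.prems(2)[of "p # zs"] pin by simp
    qed (use wins_fromI.prems in simp)
    then show "\<exists>p. p \<in> answers A B x \<and> wins_from r \<gamma> (xs' @ [p]) (\<lambda>l. Q' l \<and> constr k t (drop (length xs') l))"
      using p by blast
  qed
qed

section \<open>Translation between strategies and positions\<close>

text \<open>II's strategy recomputes the position from I's moves, choosing in every round some
  answer that preserves \<open>I\<close>.\<close>

lemma II_wins_EF_if_invariant:
  fixes I :: "'a ef_move list \<Rightarrow> ('a \<times> 'a) list \<Rightarrow> bool"
  assumes I0: "I [] []"
    and step: "\<And>h xs m. I h xs \<Longrightarrow> legal_pick D \<epsilon> A B m \<Longrightarrow> \<exists>p. p \<in> answers A B (pick m) \<and> I (h @ [m]) (xs @ [p])"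
    and fin: "\<And>h xs i. I h xs \<Longrightarrow> i < length h \<Longrightarrow> constr i (tol (h ! i)) (drop i xs)"
  shows "II_wins_EF D Appr Good \<epsilon> A B"
proof -
  define ans where "ans h xs m = (SOME p. p \<in> answers A B (pick m) \<and> I (h @ [m]) (xs @ [p]))"
    for h xs and m :: "'a ef_move"
  \<comment> \<open>Moves are appended on the right while \<open>rec_list\<close> peels off the
    head, hence the recursion along \<open>rev h\<close>.\<close>
  define pos where "pos h = rec_list [] (\<lambda>m h xs. xs @ [ans (rev h) xs m]) (rev h)" for h :: "'a ef_move list"
  have pos0: "pos [] = []" and pos_snoc: "pos (h @ [m]) = pos h @ [ans h (pos h) m]" for h m
    by (simp_all add: pos_def)
  \<comment> \<open>The answer is the component of the last pair on the side where I did not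
    play.\<close>
  define \<tau> where "\<tau> h = (case pick (last h) of Inl _ \<Rightarrow> snd (last (pos h)) | Inr _ \<Rightarrow> fst (last (pos h)))"
    for h :: "'a ef_move list"
  show ?thesis unfolding II_wins_EF_def
  proof (intro exI[of _ \<tau>] allI impI)
    fix p :: "nat \<Rightarrow> 'a ef_move" assume legal: "\<forall>k. legal_pick D \<epsilon> A B (p k)"
    let ?h = "\<lambda>n. map p [0..<n]"
    let ?a = "\<lambda>j. left_elem \<tau> (?h (Suc j))" and ?b = "\<lambda>j. right_elem \<tau> (?h (Suc j))"
    have ans_ok: "ans (?h n) (pos (?h n)) (p n) \<in> answers A B (pick (p n)) \<and>
        I (?h n @ [p n]) (pos (?h n) @ [ans (?h n) (pos (?h n)) (p n)])"
      if "I (?h n) (pos (?h n))" for n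
      unfolding ans_def using someI_ex[OF step[OF that]] legal by blast
    have I: "I (?h n) (pos (?h n))" for n
      by (induction n) (use I0 pos0 ans_ok pos_snoc in auto)
    have el: "(?a n, ?b n) = ans (?h n) (pos (?h n)) (p n)" for n
      using ans_ok[OF I, of n]
      by (auto simp: left_elem_def right_elem_def \<tau>_def pos_snoc answers_def split: sum.splits)
    have pos: "pos (?h n) = map (\<lambda>j. (?a j, ?b j)) [0..<n]" for n
    proof (induction n)
      case (Suc n)
      have "pos (?h (Suc n)) = pos (?h n) @ [(?a n, ?b n)]" unfolding el by (simp add: pos_snoc)
      then show ?case using Suc by simp
    qed (simp add: pos0)
    have "legal_answer A B \<tau> (?h (Suc n))" for n
    proof -
      have "pick (last (?h (Suc n))) \<in> Univ A <+> Univ B" using legal by (auto simp: legal_pick_def)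
      then show ?thesis using answers_iff_legal_answer[of "?h (Suc n)" A B \<tau>] ans_ok[OF I, of n]
        by (simp add: el[simplified])
    qed
    moreover have "transfers Appr A B (Good k) (tol (p k)) {k..} ?a ?b" for k
    proof (rule constr_imp_transfers)
      show "tol (p k) \<in> D" using legal by (auto simp: legal_pick_def)
      fix n assume "k \<le> n"
      show "constr k (tol (p k)) (drop k (map (\<lambda>j. (?a j, ?b j)) [0..<n]))"
      proof (cases "k < n")
        case True
        then show ?thesis using fin[OF I, of k n] unfolding pos by simp
      next
        case False
        \<comment> \<open>Here \<open>n = k\<close> and the remaining list is empty, but formulas
          without variables must still be transferred. The position after one more round guarantees
          this.\<close>
        have "constr k (tol (p k)) (drop k (map (\<lambda>j. (?a j, ?b j)) [0..<Suc k]))"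
          using fin[OF I, of k "Suc k"] unfolding pos by (simp add: nth_append)
        then show ?thesis using False legal by (auto elim!: constr_reindex simp: legal_pick_def)
      qed
    qed
    ultimately show "(\<forall>k. legal_answer A B \<tau> (?h (Suc k))) \<and>
       (\<forall>k. transfers Appr A B (Good k) (tol (p k)) {k..} ?a ?b)" by blast
  qed
qed


text \<open>By induction on the clock, all positions reached under II's strategy are won. The
  ordinal \<beta> is represented by the initial segment of \<open>r\<close> below it, whose elements
  are exactly the clocks available to I at the start.\<close>

lemma wins_from_start:
  fixes r :: "'o rel"
  assumes wo: "Well_order r" and \<beta>: "\<beta> \<in> Field r"
    and win: "II_wins_EFD D Appr Good (Restr r (underS r \<beta>)) \<epsilon> A B"
  shows "wins_from r \<beta> [] (\<lambda>_. True)"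
proof -
  let ?\<alpha> = "Restr r (underS r \<beta>)"
  have rf: "Refl r" and tr: "trans r" and an: "antisym r" and tot: "Total r" and wf: "wf (r - Id)"
    using wo by (auto simp: order_on_defs)
  have Fu: "underS r \<beta> \<subseteq> Field r" by (auto simp: underS_def Field_def)
  have F\<alpha>: "Field ?\<alpha> = underS r \<beta>"
    using rf Fu by (auto simp: Field_def refl_on_def)
  obtain \<tau> :: "('a, 'o) efd_move list \<Rightarrow> 'a" where \<tau>:
    "\<And>p. complete_EFD_play D ?\<alpha> \<epsilon> A B p \<Longrightarrow>
       (\<forall>i<length p. legal_answer A B \<tau> (take (Suc i) p)) \<and>
       (\<forall>i<length p. transfers Appr A B (Good (level (p ! i))) (tol (p ! i)) {i..<length p}
              (\<lambda>j. left_elem \<tau> (take (Suc j) p)) (\<lambda>j. right_elem \<tau> (take (Suc j) p)))"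
    using win unfolding II_wins_EFD_def by blast
  define pos where "pos p = map (\<lambda>j. (left_elem \<tau> (take (Suc j) p), right_elem \<tau> (take (Suc j) p))) [0..<length p]" for p
  have pos_snoc: "pos (p @ [m]) = pos p @ [(left_elem \<tau> (p @ [m]), right_elem \<tau> (p @ [m]))]" for p m
    by (simp add: pos_def)
  define partial where "partial p \<longleftrightarrow> (\<forall>m\<in>set p. legal_pick D \<epsilon> A B m \<and> clock m \<in> underS r \<beta>) \<and>
    (\<forall>i<length p. \<forall>j<i. (clock (p ! i), clock (p ! j)) \<in> ?\<alpha> - Id)" for p :: "('a, 'o) efd_move list"
  have extend: "partial (p @ [m])"
    if p: "partial p" and m: "legal_pick D \<epsilon> A B m" and "p \<noteq> []" and c: "clock m \<in> underS r (clock (last p))"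
    for p and m :: "('a, 'o) efd_move"
  proof -
    have lst: "clock (last p) \<in> underS r \<beta>" using p \<open>p \<noteq> []\<close> by (auto simp: partial_def)
    have less: "clock m \<in> underS r (clock (p ! j))" if "j < length p" for j
    proof (cases "j = length p - 1")
      case True
      then show ?thesis using c \<open>p \<noteq> []\<close> by (simp add: last_conv_nth)
    next
      case False
      then have "(clock (last p), clock (p ! j)) \<in> ?\<alpha> - Id"
        using p that \<open>p \<noteq> []\<close> by (auto simp: partial_def last_conv_nth)
      then show ?thesis using c tr an by (auto simp: underS_def dest: transD antisymD)
    qed
    have cm: "clock m \<in> underS r \<beta>"
      using c lst tr an by (auto simp: underS_def dest: transD antisymD)
    show ?thesis
      using p m cm less unfolding partial_def
      by (fastforce simp: nth_append less_Suc_eq underS_def)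
  qed
  \<comment> \<open>The strategy is guaranteed to succeed only on complete plays. A nonempty partial
    play is completed by at most one further move, and the conditions on the result restrict to the
    partial play.\<close>
  have good: "legal_answer A B \<tau> p \<and> (\<forall>i<length p. constr (level (p ! i)) (tol (p ! i)) (drop i (pos p)))"
    if p: "partial p" and "p \<noteq> []" for p
  proof -
    have lst: "clock (last p) \<in> underS r \<beta>" using p \<open>p \<noteq> []\<close> by (auto simp: partial_def)
    have "\<exists>q. complete_EFD_play D ?\<alpha> \<epsilon> A B q \<and> length p \<le> length q \<and> take (length p) q = p"
    proof (cases "underS r (clock (last p)) = {}")
      case True
      then have "underS ?\<alpha> (clock (last p)) = {}" by (auto simp: underS_def)
      then show ?thesis using p \<open>p \<noteq> []\<close> unfolding complete_EFD_play_def partial_def F\<alpha>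
        by (intro exI[of _ p]) auto
    next
      case False
      then obtain z where z: "z \<in> underS r (clock (last p))" "\<And>y. (y, z) \<in> r - Id \<Longrightarrow> y \<notin> underS r (clock (last p))"
        using wfE_min[OF wf] by (metis ex_in_conv)
      \<comment> \<open>Anything below \<open>z\<close> would also lie below the last clock, against
        the minimality of \<open>z\<close>. So \<open>z\<close> is the clock value 0.\<close>
      then have "underS r z = {}"
        using tr an by (fastforce simp: underS_def dest: transD antisymD)
      then have z0: "underS ?\<alpha> z = {}" by (auto simp: underS_def)
      obtain a where a: "a \<in> Univ A" using Univ_nonempty[OF A_in] by blast
      obtain t where t: "t \<in> D" "\<epsilon> < t" using D_between[OF eps_nonneg, of "\<epsilon> + 1"] by auto
      define m where "m = \<lparr>pick = Inl a, tol = t, level = 0, clock = z\<rparr>"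
      have "partial (p @ [m])"
        by (rule extend[OF p _ \<open>p \<noteq> []\<close>]) (use a t z in \<open>auto simp: m_def legal_pick_def\<close>)
      then have "complete_EFD_play D ?\<alpha> \<epsilon> A B (p @ [m])"
        using z0 unfolding complete_EFD_play_def partial_def F\<alpha> by (auto simp: m_def)
      then show ?thesis by (intro exI[of _ "p @ [m]"]) simp
    qed
    then obtain q where q: "complete_EFD_play D ?\<alpha> \<epsilon> A B q" "length p \<le> length q" "take (length p) q = p"
      by blast
    have tk: "take (Suc j) q = take (Suc j) p" if "j < length p" for j
      using q(3) that by (metis min_absorb1 Suc_leI take_take)
    have nth: "q ! i = p ! i" if "i < length p" for i
      using q(3) that by (metis nth_take)
    have "take (Suc (length p - 1)) q = p" "length p - 1 < length q"
      using tk[of "length p - 1"] q(2) \<open>p \<noteq> []\<close> by (auto simp: less_le_trans[of _ "length p"])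
    then have "legal_answer A B \<tau> p"
      using \<tau>[OF q(1), THEN conjunct1, rule_format, of "length p - 1"] by simp
    moreover have "constr (level (p ! i)) (tol (p ! i)) (drop i (pos p))" if i: "i < length p" for i
    proof -
      have "transfers Appr A B (Good (level (p ! i))) (tol (p ! i)) {i..<length q}
              (\<lambda>j. left_elem \<tau> (take (Suc j) q)) (\<lambda>j. right_elem \<tau> (take (Suc j) q))"
        using \<tau>[OF q(1), THEN conjunct2, rule_format, of i] i q(2) by (simp add: nth)
      then have "transfers Appr A B (Good (level (p ! i))) (tol (p ! i)) {i..<length p}
              (\<lambda>j. left_elem \<tau> (take (Suc j) q)) (\<lambda>j. right_elem \<tau> (take (Suc j) q))"
        using q(2) unfolding transfers_def by fastforce
      moreover have "tol (p ! i) \<in> D" using p i by (auto simp: partial_def legal_pick_def)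
      ultimately have "constr (level (p ! i)) (tol (p ! i))
          (drop i (map (\<lambda>j. (left_elem \<tau> (take (Suc j) q), right_elem \<tau> (take (Suc j) q))) [0..<length p]))"
        using i by (intro transfers_imp_constr) auto
      also have "map (\<lambda>j. (left_elem \<tau> (take (Suc j) q), right_elem \<tau> (take (Suc j) q))) [0..<length p] = pos p"
        using tk by (auto simp: pos_def)
      finally show ?thesis .
    qed
    ultimately show ?thesis by blast
  qed
  \<comment> \<open>The clock \<gamma> is that of the last move; before the first move, \<beta> is
    the bound.\<close>
  have "wins_from r \<gamma> (pos p) (\<lambda>l. \<forall>i<length p. constr (level (p ! i)) (tol (p ! i)) (drop i l))"
    if "partial p" "\<gamma> = (if p = [] then \<beta> else clock (last p))" for p \<gamma>
    using wf that
  proof (induction \<gamma> arbitrary: p rule: wf_induct_rule)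
    case (less \<gamma>)
    show ?case
    proof (rule wins_fromI)
      show "\<forall>i<length p. constr (level (p ! i)) (tol (p ! i)) (drop i (pos p))"
        using good[OF less.prems(1)] by (cases "p = []") auto
    next
      fix \<delta> x t k
      assume \<delta>: "\<delta> \<in> underS r \<gamma>" and x: "x \<in> Univ A <+> Univ B" and t: "t \<in> D" "\<epsilon> < t"
      define m where "m = \<lparr>pick = x, tol = t, level = k, clock = \<delta>\<rparr>"
      have m: "legal_pick D \<epsilon> A B m" using x t by (simp add: m_def legal_pick_def)
      have pm: "partial (p @ [m])"
      proof (cases "p = []")
        case True
        then show ?thesis using m \<delta> less.prems(2) by (simp add: partial_def m_def)
      next
        case False
        then show ?thesis using extend[OF less.prems(1) m False] \<delta> less.prems(2) by (simp add: m_def)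
      qed
      have "legal_answer A B \<tau> (p @ [m])" using good[OF pm] by simp
      then have "(left_elem \<tau> (p @ [m]), right_elem \<tau> (p @ [m])) \<in> answers A B x"
        using answers_iff_legal_answer[of "p @ [m]" A B \<tau>] x by (simp add: m_def)
      moreover have "wins_from r \<delta> (pos (p @ [m]))
          (\<lambda>l. \<forall>i<length (p @ [m]). constr (level ((p @ [m]) ! i)) (tol ((p @ [m]) ! i)) (drop i l))"
        by (rule less.IH[OF _ pm]) (use \<delta> in \<open>auto simp: underS_def m_def\<close>)
      moreover have "(\<lambda>l. \<forall>i<length (p @ [m]). constr (level ((p @ [m]) ! i)) (tol ((p @ [m]) ! i)) (drop i l)) =
          (\<lambda>l. (\<forall>i<length p. constr (level (p ! i)) (tol (p ! i)) (drop i l)) \<and> constr k t (drop (length (pos p)) l))"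
        by (auto simp: fun_eq_iff nth_append less_Suc_eq m_def pos_def)
      ultimately show "\<exists>q. q \<in> answers A B x \<and> wins_from r \<delta> (pos p @ [q])
          (\<lambda>l. (\<forall>i<length p. constr (level (p ! i)) (tol (p ! i)) (drop i l)) \<and> constr k t (drop (length (pos p)) l))"
        unfolding pos_snoc by auto
    qed
  qed
  from this[of "[]" \<beta>] show ?thesis by (simp add: partial_def pos_def)
qed


section \<open>The case of infinite density\<close>

text \<open>The slacks \<open>s i\<close> and tolerances \<open>t i\<close> are common to all clocks
  \<beta>, and the level of round \<open>i\<close> is \<open>i\<close>, as the infinite game
  demands. Both parameters may be readjusted after each round, within the strict bounds.\<close>

definition position_inv :: "'o rel \<Rightarrow> 'a ef_move list \<Rightarrow> ('a \<times> 'a) list \<Rightarrow> bool" where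
  "position_inv r h xs \<longleftrightarrow> length xs = length h \<and> set xs \<subseteq> Univ A \<times> Univ B \<and> (\<forall>m\<in>set h. tol m \<in> D) \<and>
    (\<exists>s t. (\<forall>i<length h. s i \<in> D \<and> 0 < s i \<and> t i \<in> D \<and> t i < tol (h ! i)) \<and>
       (\<forall>\<beta>\<in>Field r. wins_from r \<beta> xs (\<lambda>l. \<forall>i<length h. weak_constr i (s i) (t i) (drop i l))))"

text \<open>The parameters pass through three stages: \<open>s\<close>, \<open>t\<close> before the
  move; \<open>s2\<close>, \<open>t2\<close> with the constraint of the new round added;
  \<open>s3\<close>, \<open>t3\<close> after the winning answers, which vary with the clock, are
  replaced by one common answer.\<close>

lemma position_inv_step:
  fixes \<kappa> :: "'o rel"
  assumes \<kappa>: "Cinfinite \<kappa>"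
    and SA: "SA \<subseteq> Univ A" "|SA| \<le>o \<kappa>" "\<And>a d. a \<in> Univ A \<Longrightarrow> 0 < d \<Longrightarrow> \<exists>c\<in>SA. dst A c a < d"
    and SB: "SB \<subseteq> Univ B" "|SB| \<le>o \<kappa>" "\<And>b d. b \<in> Univ B \<Longrightarrow> 0 < d \<Longrightarrow> \<exists>c\<in>SB. dst B b c < d"
    and inv: "position_inv (cardSuc \<kappa>) h xs" and legal: "legal_pick D \<epsilon> A B m"
  shows "\<exists>p. p \<in> answers A B (pick m) \<and> position_inv (cardSuc \<kappa>) (h @ [m]) (xs @ [p])"
proof -
  let ?r = "cardSuc \<kappa>"
  let ?n = "length h"
  have wo: "Well_order ?r" and co: "Card_order ?r" and inf: "\<not> finite (Field ?r)"
    using \<kappa> Cinfinite_cardSuc[OF \<kappa>] by (auto simp: cinfinite_def card_order_on_def)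
  have x: "pick m \<in> Univ A <+> Univ B" and m: "tol m \<in> D" "\<epsilon> < tol m"
    using legal by (auto simp: legal_pick_def)
  obtain s t where st: "\<And>i. i < ?n \<Longrightarrow> s i \<in> D \<and> 0 < s i \<and> t i \<in> D \<and> t i < tol (h ! i)"
    and win: "\<And>\<beta>. \<beta> \<in> Field ?r \<Longrightarrow> wins_from ?r \<beta> xs (\<lambda>l. \<forall>i<?n. weak_constr i (s i) (t i) (drop i l))"
    and len: "length xs = ?n" and xs: "set xs \<subseteq> Univ A \<times> Univ B" and hD: "\<forall>m\<in>set h. tol m \<in> D"
    using inv unfolding position_inv_def by blast
  \<comment> \<open>\<open>e0\<close> is the tolerance played in the dynamic game; the gap up to
    \<open>tol m\<close> leaves room for the slack \<open>s0\<close> and more.\<close>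
  obtain e0 where e0: "e0 \<in> D" "\<epsilon> < e0" "e0 < tol m" using D_between[OF eps_nonneg m(2)] by blast
  obtain s0 where s0: "s0 \<in> D" "0 < s0" "s0 < tol m - e0" using D_between[of 0 "tol m - e0"] e0 by auto
  define s2 where "s2 = s(?n := s0)"
  define t2 where "t2 = t(?n := s0 + e0)"
  have st2: "s2 i \<in> D \<and> 0 < s2 i \<and> t2 i \<in> D \<and> t2 i < tol ((h @ [m]) ! i)" if "i < Suc ?n" for i
    using that st[of i] s0 e0 by (auto simp: s2_def t2_def D_add nth_append less_Suc_eq)
  define Q2 where "Q2 l \<longleftrightarrow> (\<forall>i<Suc ?n. weak_constr i (s2 i) (t2 i) (drop i l))" for l
  have ans2: "\<exists>p. p \<in> answers A B (pick m) \<and> wins_from ?r \<beta> (xs @ [p]) Q2" if \<beta>: "\<beta> \<in> Field ?r" for \<beta>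
  proof -
    \<comment> \<open>The round consumes the clock \<beta>, so it starts from a larger one, which
      exists as an infinite cardinal is a limit.\<close>
    obtain \<beta>' where "\<beta>' \<in> Field ?r" "\<beta> \<noteq> \<beta>'" "(\<beta>, \<beta>') \<in> ?r"
      using infinite_Card_order_limit[OF co inf \<beta>] by blast
    then have \<beta>': "\<beta>' \<in> Field ?r" "\<beta> \<in> underS ?r \<beta>'" by (auto simp: underS_def)
    \<comment> \<open>The level is raised just enough for \<open>constr_imp_weak_constr\<close> to
      yield slack \<open>s0\<close> at level \<open>?n\<close>.\<close>
    obtain p where p: "p \<in> answers A B (pick m)"
      and w: "wins_from ?r \<beta> (xs @ [p]) (\<lambda>l. (\<forall>i<?n. weak_constr i (s i) (t i) (drop i l)) \<and>
             constr (nat \<lceil>real ?n * exp s0\<rceil>) e0 (drop (length xs) l))"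
      by (rule wins_from_step[OF win[OF \<beta>'(1)] \<beta>'(2) x e0(1,2)])
    have "wins_from ?r \<beta> (xs @ [p]) Q2"
    proof (rule wins_from_transfer[OF w refl])
      fix zs assume zs: "set zs \<subseteq> Univ A \<times> Univ B"
        and q: "(\<forall>i<?n. weak_constr i (s i) (t i) (drop i ((xs @ [p]) @ zs))) \<and>
             constr (nat \<lceil>real ?n * exp s0\<rceil>) e0 (drop (length xs) ((xs @ [p]) @ zs))"
      have "p \<in> Univ A \<times> Univ B" using p answers_subset[OF x] by blast
      then have "set (drop (length xs) ((xs @ [p]) @ zs)) \<subseteq> Univ A \<times> Univ B" using zs by auto
      then have "weak_constr ?n s0 (s0 + e0) (drop ?n ((xs @ [p]) @ zs))"
        using q s0 e0 len by (intro constr_imp_weak_constr) auto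
      then show "Q2 ((xs @ [p]) @ zs)" using q
        by (auto simp: Q2_def s2_def t2_def less_Suc_eq)
    qed
    then show ?thesis using p by blast
  qed
  have "\<forall>i\<in>{..<Suc ?n}. \<exists>\<delta> s' u. 0 < \<delta> \<and> s' \<in> D \<and> 0 < s' \<and> u \<in> D \<and> u < tol ((h @ [m]) ! i) \<and>
    (\<forall>l l'. list_all2 (near \<delta>) l l' \<longrightarrow> set l \<subseteq> Univ A \<times> Univ B \<longrightarrow> set l' \<subseteq> Univ A \<times> Univ B \<longrightarrow>
       weak_constr i (s2 i) (t2 i) l \<longrightarrow> weak_constr i s' u l')"
    using st2 by (intro ballI weak_constr_perturb) auto
  from this[unfolded bchoice_iff] obtain \<delta> s3 t3 where st3: "\<And>i. i < Suc ?n \<Longrightarrow> 0 < \<delta> i \<and> s3 i \<in> D \<and> 0 < s3 i \<and> t3 i \<in> D \<and>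
      t3 i < tol ((h @ [m]) ! i)"
    and pert: "\<And>i l l'. i < Suc ?n \<Longrightarrow> list_all2 (near (\<delta> i)) l l' \<Longrightarrow> set l \<subseteq> Univ A \<times> Univ B \<Longrightarrow>
       set l' \<subseteq> Univ A \<times> Univ B \<Longrightarrow> weak_constr i (s2 i) (t2 i) l \<Longrightarrow> weak_constr i (s3 i) (t3 i) l'"
    unfolding Ball_def lessThan_iff by metis
  \<comment> \<open>One distance for the finitely many rounds. It is fixed before any clock is
    considered, as the pigeonhole argument below requires.\<close>
  define d where "d = Min (\<delta> ` {..<Suc ?n})"
  have "0 < d" unfolding d_def using st3 by (subst Min_gr_iff) auto
  moreover have "d \<le> \<delta> i" if "i < Suc ?n" for i
    unfolding d_def using that by (intro Min_le) auto
  ultimately have d: "0 < d" "\<And>i. i < Suc ?n \<Longrightarrow> d \<le> \<delta> i" by blast+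
  define Q3 where "Q3 l \<longleftrightarrow> (\<forall>i<Suc ?n. weak_constr i (s3 i) (t3 i) (drop i l))" for l
  \<comment> \<open>The candidates pair I's element with the dense subset of the other
    structure.\<close>
  obtain S where S: "S \<subseteq> answers A B (pick m)" "|S| \<le>o \<kappa>"
    "\<And>p. p \<in> answers A B (pick m) \<Longrightarrow> \<exists>q\<in>S. near d p q"
  proof (cases "pick m")
    case (Inl a)
    have "|Pair a ` SB| \<le>o \<kappa>" using card_of_image SB(2) ordLeq_transitive by blast
    moreover have "a \<in> Univ A" using x Inl by auto
    then have "dst A a a < d" using d(1) metric[OF A_in] by (simp add: Metric_space.mdist_zero)
    ultimately show ?thesis using SB d(1) Inl
      by (intro that[of "Pair a ` SB"]) (auto simp: near_def)
  next
    case (Inr b)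
    have "|(\<lambda>a. (a, b)) ` SA| \<le>o \<kappa>" using card_of_image SA(2) ordLeq_transitive by blast
    moreover have "b \<in> Univ B" using x Inr by auto
    then have "dst B b b < d" using d(1) metric[OF B_in] by (simp add: Metric_space.mdist_zero)
    ultimately show ?thesis using SA d(1) Inr
      by (intro that[of "(\<lambda>a. (a, b)) ` SA"]) (auto simp: near_def)
  qed
  have "\<exists>q\<in>S. \<forall>\<beta>\<in>Field ?r. \<exists>p. p \<in> answers A B (pick m) \<and> near d p q \<and> wins_from ?r \<beta> (xs @ [p]) Q2"
  proof (rule cardSuc_pigeonhole[OF \<kappa> S(2)])
    fix \<beta> assume "\<beta> \<in> Field ?r"
    then show "\<exists>q\<in>S. \<exists>p. p \<in> answers A B (pick m) \<and> near d p q \<and> wins_from ?r \<beta> (xs @ [p]) Q2"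
      using ans2 S(3) by blast
  next
    fix \<beta> \<gamma> q assume "(\<gamma>, \<beta>) \<in> ?r"
      "\<exists>p. p \<in> answers A B (pick m) \<and> near d p q \<and> wins_from ?r \<beta> (xs @ [p]) Q2"
    then show "\<exists>p. p \<in> answers A B (pick m) \<and> near d p q \<and> wins_from ?r \<gamma> (xs @ [p]) Q2"
      using wins_from_antimono[OF _ wo] by blast
  qed
  then obtain q where q: "q \<in> S" and qwin: "\<And>\<beta>. \<beta> \<in> Field ?r \<Longrightarrow>
      \<exists>p. p \<in> answers A B (pick m) \<and> near d p q \<and> wins_from ?r \<beta> (xs @ [p]) Q2"
    by blast
  have q': "q \<in> answers A B (pick m)" "q \<in> Univ A \<times> Univ B" using q S(1) answers_subset[OF x] by blast+
  have "wins_from ?r \<beta> (xs @ [q]) Q3" if \<beta>: "\<beta> \<in> Field ?r" for \<beta>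
  proof -
    obtain p where p: "p \<in> answers A B (pick m)" "near d p q" and w: "wins_from ?r \<beta> (xs @ [p]) Q2"
      using qwin[OF \<beta>] by blast
    have p': "p \<in> Univ A \<times> Univ B" using p(1) answers_subset[OF x] by blast
    show ?thesis
    proof (rule wins_from_transfer[OF w])
      fix zs assume zs: "set zs \<subseteq> Univ A \<times> Univ B" and Q: "Q2 ((xs @ [p]) @ zs)"
      \<comment> \<open>Only the last answer changes; all other pairs, later ones included, are near
        themselves.\<close>
      have nr: "near (\<delta> i) u u" if "i < Suc ?n" "u \<in> Univ A \<times> Univ B" for i u
        using near_refl st3 that by blast
      have la: "list_all2 (near (\<delta> i)) ((xs @ [p]) @ zs) ((xs @ [q]) @ zs)" if i: "i < Suc ?n" for i
      proof -
        have "near (\<delta> i) p q" using p(2) d(2)[OF i] by (auto simp: near_def)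
        then show ?thesis using nr[OF i] xs zs
          by (intro list_all2_appendI) (auto simp: list_all2_same)
      qed
      have sub: "set (drop i ((xs @ [u]) @ zs)) \<subseteq> Univ A \<times> Univ B" if "u \<in> Univ A \<times> Univ B" for i u
        using that xs zs by (intro order_trans[OF set_drop_subset]) auto
      have "weak_constr i (s3 i) (t3 i) (drop i ((xs @ [q]) @ zs))" if i: "i < Suc ?n" for i
        using Q i pert[OF i list_all2_dropI[OF la[OF i]] sub[OF p'] sub[OF q'(2)]]
        by (simp only: Q2_def)
      then show "Q3 ((xs @ [q]) @ zs)" by (simp add: Q3_def)
    qed simp
  qed
  then have "position_inv ?r (h @ [m]) (xs @ [q])"
    unfolding position_inv_def
    using len xs hD m q'(2) st3
    by (intro conjI exI[of _ s3] exI[of _ t3]) (auto simp: Q3_def[abs_def])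
  then show ?thesis using q'(1) by blast
qed

text \<open>Discarding the slack in \<open>position_inv\<close> leaves the winning condition of the
  infinite game.\<close>

lemma II_wins_EF_if_infinite:
  fixes \<kappa> :: "'o rel"
  assumes \<kappa>: "Cinfinite \<kappa>"
    and SA: "SA \<subseteq> Univ A" "|SA| \<le>o \<kappa>" "\<And>a d. a \<in> Univ A \<Longrightarrow> 0 < d \<Longrightarrow> \<exists>c\<in>SA. dst A c a < d"
    and SB: "SB \<subseteq> Univ B" "|SB| \<le>o \<kappa>" "\<And>b d. b \<in> Univ B \<Longrightarrow> 0 < d \<Longrightarrow> \<exists>c\<in>SB. dst B b c < d"
    and win: "\<And>\<beta>. \<beta> \<in> Field (cardSuc \<kappa>) \<Longrightarrow> wins_from (cardSuc \<kappa>) \<beta> [] (\<lambda>_. True)"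
  shows "II_wins_EF D Appr Good \<epsilon> A B"
proof (rule II_wins_EF_if_invariant[where I = "position_inv (cardSuc \<kappa>)"])
  show "position_inv (cardSuc \<kappa>) [] []" using win by (simp add: position_inv_def)
  show "\<exists>p. p \<in> answers A B (pick m) \<and> position_inv (cardSuc \<kappa>) (h @ [m]) (xs @ [p])"
    if "position_inv (cardSuc \<kappa>) h xs" "legal_pick D \<epsilon> A B m" for h xs m
    by (rule position_inv_step[OF \<kappa> SA SB that])
next
  fix h xs i assume inv: "position_inv (cardSuc \<kappa>) h xs" and i: "i < length h"
  obtain s t where st: "s i \<in> D" "t i \<in> D" "t i < tol (h ! i)"
    and win: "\<And>\<beta>. \<beta> \<in> Field (cardSuc \<kappa>) \<Longrightarrow>
      wins_from (cardSuc \<kappa>) \<beta> xs (\<lambda>l. \<forall>i<length h. weak_constr i (s i) (t i) (drop i l))"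
    and xs: "set xs \<subseteq> Univ A \<times> Univ B" and tD: "tol (h ! i) \<in> D"
    using inv i unfolding position_inv_def by fastforce
  obtain \<beta> where "\<beta> \<in> Field (cardSuc \<kappa>)"
    using Cinfinite_cardSuc[OF \<kappa>] unfolding cinfinite_def by (metis ex_in_conv finite.emptyI)
  then have "weak_constr i (s i) (t i) (drop i xs)"
    using wins_from_constraint[OF win] i by blast
  then show "constr i (tol (h ! i)) (drop i xs)"
    by (rule weak_constr_imp_constr)
      (use st tD order_trans[OF set_drop_subset xs] in simp_all)
qed


section \<open>The case of finite density\<close>

text \<open>I plays the elements of \<open>ms\<close>, always with the largest clock left, so each
  round costs one clock. The constraint of the first round spans all answers and is carried along
  inside \<open>Q\<close>.\<close>

lemma wins_from_play:
  assumes wo: "Well_order r" and "t \<in> D" "\<epsilon> < t"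
  shows "wins_from r \<beta> xs Q \<Longrightarrow> finite (underS r \<beta>) \<Longrightarrow> length ms \<le> card (underS r \<beta>) \<Longrightarrow>
    set ms \<subseteq> Univ A <+> Univ B \<Longrightarrow>
    \<exists>ps. list_all2 (\<lambda>x p. p \<in> answers A B x) ms ps \<and> Q (xs @ ps) \<and>
      (ms \<noteq> [] \<longrightarrow> constr k t (drop (length xs) (xs @ ps)))"
proof (induction ms arbitrary: \<beta> xs Q)
  case Nil
  then show ?case using wins_from_constraint by force
next
  case (Cons x ms)
  have Fu: "underS r \<beta> \<subseteq> Field r" by (auto simp: underS_def Field_def)
  have ne: "underS r \<beta> \<noteq> {}" using Cons.prems(3) by auto
  obtain \<gamma> where \<gamma>: "\<gamma> \<in> underS r \<beta>" "underS r \<beta> \<subseteq> insert \<gamma> (underS r \<gamma>)"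
    using finite_subset_has_max[OF wo Cons.prems(2) ne Fu] by blast
  have "underS r \<gamma> \<subseteq> underS r \<beta>"
    using wo \<gamma>(1) by (intro underS_incr) (auto simp: order_on_defs underS_def)
  then have fin: "finite (underS r \<gamma>)" using Cons.prems(2) finite_subset by blast
  have "card (underS r \<beta>) \<le> Suc (card (underS r \<gamma>))"
    using card_mono[OF _ \<gamma>(2)] fin by (auto simp: card_insert_if split: if_splits)
  then have len: "length ms \<le> card (underS r \<gamma>)" using Cons.prems(3) by simp
  obtain p where p: "p \<in> answers A B x"
    and w: "wins_from r \<gamma> (xs @ [p]) (\<lambda>l. Q l \<and> constr k t (drop (length xs) l))"
    using wins_from_step[OF Cons.prems(1) \<gamma>(1) _ assms(2,3), of x k] Cons.prems(4) by auto
  from Cons.IH[OF w fin len] Cons.prems(4) obtain ps where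
    "list_all2 (\<lambda>x p. p \<in> answers A B x) ms ps"
    "Q ((xs @ [p]) @ ps) \<and> constr k t (drop (length xs) ((xs @ [p]) @ ps))"
    by auto
  then show ?case using p by (intro exI[of _ "p # ps"]) simp
qed

text \<open>II answers along one relation between the universes; apart from legality of the moves,
  the invariant just says that all pairs belong to it.\<close>

lemma II_wins_EF_if_finite:
  assumes fin: "finite (Univ A)" "finite (Univ B)"
    and wo: "Well_order r" and win: "wins_from r \<beta> [] (\<lambda>_. True)"
    and card: "finite (underS r \<beta>)" "card (Univ A <+> Univ B) \<le> card (underS r \<beta>)"
  shows "II_wins_EF D Appr Good \<epsilon> A B"
proof -
  let ?U = "Univ A <+> Univ B"
  define full where "full R \<longleftrightarrow> R \<subseteq> Univ A \<times> Univ B \<and> (\<forall>x\<in>?U. \<exists>p\<in>R. p \<in> answers A B x)" for R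
  define ok where "ok k t R \<longleftrightarrow> (\<forall>l. set l \<subseteq> R \<longrightarrow> constr k t l)" for k t R
  have ex: "\<exists>R. full R \<and> ok k t R" if t: "t \<in> D" "\<epsilon> < t" for k t
  proof -
    \<comment> \<open>I enumerates both structures, so that the pairs played form a full
      relation.\<close>
    obtain ms where ms: "set ms = ?U" "distinct ms" using finite_distinct_list[of ?U] fin by auto
    then have "length ms \<le> card (underS r \<beta>)" using card(2) distinct_card[OF ms(2)] by simp
    then obtain ps where ps: "list_all2 (\<lambda>x p. p \<in> answers A B x) ms ps"
      and c: "ms \<noteq> [] \<longrightarrow> constr k t ps"
      using wins_from_play[OF wo t win card(1), of ms k] ms(1) by auto
    have "ms \<noteq> []" using ms(1) Univ_nonempty[OF A_in] by auto
    then have "ok k t (set ps)" using c constr_reindex t(1) by (auto simp: ok_def)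
    moreover have "full (set ps)"
      unfolding full_def
    proof (intro conjI ballI subsetI)
      fix p assume "p \<in> set ps"
      then obtain x where "x \<in> set ms" "p \<in> answers A B x"
        using ps by (fastforce simp: in_set_conv_nth list_all2_conv_all_nth)
      then show "p \<in> Univ A \<times> Univ B" using ms(1) answers_subset by blast
    next
      fix x assume "x \<in> ?U"
      then show "\<exists>p\<in>set ps. p \<in> answers A B x"
        using ps unfolding ms(1)[symmetric] by (fastforce simp: in_set_conv_nth list_all2_conv_all_nth)
    qed
    ultimately show ?thesis by blast
  qed
  have ok_mono: "ok k' t' R" if "ok k t R" "k' \<le> k" "t \<le> t'" "t \<in> D" "t' \<in> D" "full R" for k t k' t' R
    using that constr_mono[OF _ that(2-5)] unfolding ok_def full_def by (meson order_trans)
  have "\<exists>R. full R \<and> (\<forall>k t. t \<in> D \<longrightarrow> \<epsilon> < t \<longrightarrow> ok k t R)"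
  proof (rule ccontr)
    \<comment> \<open>Every full relation would have its own counterexample. The greatest level and
      the least tolerance among these finitely many form a demand at least as hard as each of them,
      yet \<open>ex\<close> meets it.\<close>
    assume "\<not> ?thesis"
    then have "\<forall>R. \<exists>k t. full R \<longrightarrow> t \<in> D \<and> \<epsilon> < t \<and> \<not> ok k t R" by blast
    then obtain k t where kt: "\<And>R. full R \<Longrightarrow> t R \<in> D \<and> \<epsilon> < t R \<and> \<not> ok (k R) (t R) R"
      by metis
    let ?F = "Collect full"
    have finF: "finite ?F"
      by (rule finite_subset[of _ "Pow (Univ A \<times> Univ B)"]) (auto simp: full_def fin)
    obtain t1 where t1: "t1 \<in> D" "\<epsilon> < t1" using D_between[OF eps_nonneg, of "\<epsilon> + 1"] by auto
    have neF: "?F \<noteq> {}" using ex[OF t1] by blast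
    define k0 where "k0 = Max (k ` ?F)"
    define t0 where "t0 = Min (t ` ?F)"
    have "t0 \<in> t ` ?F" unfolding t0_def using finF neF by (intro Min_in) auto
    then have "t0 \<in> D" "\<epsilon> < t0" using kt by auto
    then obtain R where R: "full R" "ok k0 t0 R" using ex by blast
    have "k R \<le> k0" "t0 \<le> t R" using R(1) finF by (auto simp: k0_def t0_def)
    then have "ok (k R) (t R) R" using ok_mono R kt \<open>t0 \<in> D\<close> by blast
    then show False using kt R(1) by blast
  qed
  then obtain R where R: "full R" and ok: "\<And>k t. t \<in> D \<Longrightarrow> \<epsilon> < t \<Longrightarrow> ok k t R" by blast
  show ?thesis
  proof (rule II_wins_EF_if_invariant[where I = "\<lambda>h xs. set xs \<subseteq> R \<and> (\<forall>m\<in>set h. legal_pick D \<epsilon> A B m)"])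
    fix h :: "'a ef_move list" and xs and m :: "'a ef_move"
    assume I: "set xs \<subseteq> R \<and> (\<forall>m\<in>set h. legal_pick D \<epsilon> A B m)" and m: "legal_pick D \<epsilon> A B m"
    have "pick m \<in> ?U" using m by (simp add: legal_pick_def)
    then obtain p where p: "p \<in> R" "p \<in> answers A B (pick m)"
      using R[unfolded full_def, THEN conjunct2, THEN bspec] by metis
    show "\<exists>p. p \<in> answers A B (pick m) \<and> set (xs @ [p]) \<subseteq> R \<and> (\<forall>m\<in>set (h @ [m]). legal_pick D \<epsilon> A B m)"
      using I m p by (intro exI[of _ p]) auto
  next
    fix h :: "'a ef_move list" and xs i
    assume I: "set xs \<subseteq> R \<and> (\<forall>m\<in>set h. legal_pick D \<epsilon> A B m)" and i: "i < length h"
    then have "legal_pick D \<epsilon> A B (h ! i)" by simp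
    then have "ok i (tol (h ! i)) R" using ok by (simp add: legal_pick_def)
    then show "constr i (tol (h ! i)) (drop i xs)"
      using I set_drop_subset[of i xs] unfolding ok_def by blast
  qed simp
qed

section \<open>Dense sets and the case distinction\<close>

text \<open>Finite sets are closed in a metric space, so a finite dense set is the whole universe.
  Both orders of the distance are given to suit \<open>near\<close>.\<close>

lemma Univ_dense:
  assumes "C \<in> K" "is_dense_in (Metric_space.mtopology (Univ C) (dst C)) S"
  shows "S \<subseteq> Univ C" "c \<in> Univ C \<Longrightarrow> 0 < d \<Longrightarrow> \<exists>y\<in>S. dst C c y < d \<and> dst C y c < d"
    "finite S \<Longrightarrow> S = Univ C"
proof -
  interpret M: Metric_space "Univ C" "dst C" using metric assms(1) .
  show S: "S \<subseteq> Univ C" using assms(2) by (simp add: is_dense_in_def)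
  have cl: "M.mtopology closure_of S = Univ C" using assms(2) by (simp add: is_dense_in_def)
  show "\<exists>y\<in>S. dst C c y < d \<and> dst C y c < d" if "c \<in> Univ C" "0 < d"
  proof -
    have "\<exists>y\<in>S. dst C c y < d" using cl that unfolding M.metric_closure_of by auto
    then show ?thesis by (simp add: M.commute)
  qed
  show "S = Univ C" if "finite S"
    using cl closedin_Hausdorff_finite[OF M.Hausdorff_space_mtopology] S that
    by (simp add: closure_of_closedin)
qed

theorem II_wins_EF_if_all_EFD:
  assumes win: "\<And>\<alpha> :: ('a + 'a) set rel. \<lbrakk>Well_order \<alpha>; \<alpha> <o cardSuc (dens dst A +c dens dst B)\<rbrakk>
           \<Longrightarrow> II_wins_EFD D Appr Good \<alpha> \<epsilon> A B"
  shows "II_wins_EF D Appr Good \<epsilon> A B"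
proof -
  let ?\<kappa> = "dens dst A +c dens dst B"
  let ?r = "cardSuc ?\<kappa>"
  obtain SA where SA: "is_dense_in (Metric_space.mtopology (Univ A) (dst A)) SA" "dens dst A = |SA|"
    using density_character_attained unfolding dens_def by metis
  obtain SB where SB: "is_dense_in (Metric_space.mtopology (Univ B) (dst B)) SB" "dens dst B = |SB|"
    using density_character_attained unfolding dens_def by metis
  have \<kappa>: "?\<kappa> = |SA <+> SB|" by (simp add: csum_def SA(2) SB(2) Field_card_of)
  have co\<kappa>: "Card_order ?\<kappa>" unfolding \<kappa> by (rule card_of_Card_order)
  have co: "Card_order ?r" by (rule cardSuc_Card_order[OF co\<kappa>])
  then have wo: "Well_order ?r" by (simp add: card_order_on_def)
  have gr: "?\<kappa> <o ?r" by (rule cardSuc_greater[OF co\<kappa>])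
  \<comment> \<open>The hypothesis is applied to the proper initial segments of the successor
    cardinal itself.\<close>
  have start: "wins_from ?r \<beta> [] (\<lambda>_. True)" if "\<beta> \<in> Field ?r" for \<beta>
  proof (rule wins_from_start[OF wo that win])
    show "Well_order (Restr ?r (underS ?r \<beta>))" by (rule Well_order_Restr[OF wo])
    show "Restr ?r (underS ?r \<beta>) <o ?r" using that by (intro underS_Restr_ordLess[OF wo]) auto
  qed
  show ?thesis
  proof (cases "finite (SA <+> SB)")
    case False
    then have inf: "Cinfinite ?\<kappa>"
      unfolding \<kappa> cinfinite_def Field_card_of using False card_of_card_order_on by blast
    have "|SA| \<le>o ?\<kappa>" "|SB| \<le>o ?\<kappa>"
      unfolding SA(2) SB(2) by (auto intro: ordLeq_csum1 ordLeq_csum2 card_of_Card_order)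
    then show ?thesis
      using Univ_dense[OF A_in SA(1)] Univ_dense[OF B_in SB(1)] start
      by (intro II_wins_EF_if_infinite[OF inf, of SA SB]) blast+
  next
    case True
    then have U: "SA = Univ A" "SB = Univ B"
      using Univ_dense(3)[OF A_in SA(1)] Univ_dense(3)[OF B_in SB(1)] by auto
    have finr: "finite (Field ?r)" using cardSuc_finite[OF co\<kappa>] True by (simp only: \<kappa> Field_card_of)
    have "\<not> ?r \<le>o ?\<kappa>" using gr not_ordLess_ordLeq by blast
    then have "\<not> |Field ?r| \<le>o |SA <+> SB|"
      using card_of_Field_ordIso[OF co] \<kappa> ordIso_ordLeq_trans ordIso_symmetric by metis
    then have lt: "card (SA <+> SB) < card (Field ?r)"
      using finr True by (metis card_of_ordLeq inj_on_iff_card_le not_le)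
    then have "Field ?r \<noteq> {}" by auto
    \<comment> \<open>The finite successor has more elements than \<open>?\<kappa>\<close>, so below
      its largest element \<beta> there are still at least as many clocks as elements to be
      played.\<close>
    then obtain \<beta> where \<beta>: "\<beta> \<in> Field ?r" "Field ?r \<subseteq> insert \<beta> (underS ?r \<beta>)"
      using finite_subset_has_max[OF wo finr] by blast
    have finu: "finite (underS ?r \<beta>)"
      using finr by (rule rev_finite_subset) (auto simp: underS_def Field_def)
    have "card (Field ?r) \<le> Suc (card (underS ?r \<beta>))"
      using card_mono[OF _ \<beta>(2)] finu by (auto simp: card_insert_if split: if_splits)
    then show ?thesis
      using II_wins_EF_if_finite[OF _ _ wo start[OF \<beta>(1)] finu] True lt by (simp add: U)
  qed
qed

end

theorem theorem4p13:
  fixes L :: "('f, 'r) vocabulary"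
    and K :: "('f, 'r, 'a) L_structure set"
    and D :: "real set"
    and Appr :: "('f, 'r) atom \<Rightarrow> real \<Rightarrow> ('f, 'r) atom"
    and neg :: "('f, 'r) atom \<Rightarrow> ('f, 'r) atom"
    and dst :: "('f, 'r, 'a) L_structure \<Rightarrow> 'a \<Rightarrow> 'a \<Rightarrow> real"
    and Iso :: "real \<Rightarrow> ('f, 'r, 'a) L_structure \<Rightarrow> ('f, 'r, 'a) L_structure \<Rightarrow> ('a \<Rightarrow> 'a) set"
    and Good :: "nat \<Rightarrow> ('f, 'r) atom set"
    and A B :: "('f, 'r, 'a) L_structure"
    and \<epsilon> :: real
  assumes "good_vocabulary L K D Appr neg dst Iso Good"
    and "A \<in> K" and "B \<in> K"
    and "\<epsilon> \<in> D" and "\<epsilon> \<ge> 0"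
    and "\<And>\<alpha> :: ('a + 'a) set rel. \<lbrakk>Well_order \<alpha>; \<alpha> <o cardSuc (dens dst A +c dens dst B)\<rbrakk>
           \<Longrightarrow> II_wins_EFD D Appr Good \<alpha> \<epsilon> A B"
  shows "II_wins_EF D Appr Good \<epsilon> A B"
proof -
  interpret EF_games L K D Appr neg dst Iso Good A B \<epsilon>
    using assms(1-4) by (intro EF_games.intro EF_games_axioms.intro)
  show ?thesis using assms(6) by (rule II_wins_EF_if_all_EFD)
qed

end
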